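(* Let $\Omega\subset\mathbb{R}^N$ be a bounded open connected set and $\Theta$ a proper elliptic map on $\Omega$ such that for every open $X\subset\subset\Omega$ the following holds: for all sufficiently large $R>0$ and all $\eta>0$ there exists $\delta=\delta(R,\eta,X)>0$ such that for all $x,y\in X$ with $|x-y|<\delta$, $$\big(\Theta(x)\cap([-R,R]\times\mathcal{S}(N))\big)+(0,\eta I)\subset\Theta(y).$$ If $u\in\mathrm{USC}(\overline\Omega)$ is $\Theta$-subharmonic in $\Omega$, $v\in\mathrm{LSC}(\overline\Omega)$ is $\Theta$-superharmonic in $\Omega$, and $u\le v$ on $\partial\Omega$, then $u\le v$ in $\Omega$.
   Context: $\mathcal{S}(N)$: real symmetric $N\times N$ matrices with the usual partial order; $I$ identity. $\mathcal{Q}:=\{(s,P): s\le0,\ P\ge0\}$. A proper elliptic map $\Theta$ on $\Omega$ assigns to each $x$ a closed, nonempty set $\Theta(x)\subsetneq\mathbb{R}\times\mathcal{S}(N)$ with $\Theta(x)+\mathcal{Q}\subset\Theta(x)$. $J^+_{x_0}u:=\{(\varphi(x_0),D^2\varphi(x_0)):\varphi$ is $C^2$ near $x_0$, $u\le\varphi$ near $x_0$, $u(x_0)=\varphi(x_0)\}$, $J^-_{x_0}u$ likewise with $u\ge\varphi$. $u\in\mathrm{USC}(\Omega)$ is $\Theta$-subharmonic in $\Omega$ if $J^+_{x_0}u\subset\Theta(x_0)$ for all $x_0\in\Omega$; $v\in\mathrm{LSC}(\Omega)$ is $\Theta$-superharmonic in $\Omega$ if $J^-_{x_0}v\subset(\mathbb{R}\times\mathcal{S}(N))\setminus(\Theta(x_0))^\circ$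 for all $x_0\in\Omega$. *)

theory Defs
  imports "HOL-Analysis.Analysis"
begin

definition SymM :: "(real^'n^'n) set" where
  "SymM = {A. transpose A = A}"

definition psd :: "real^'n^'n \<Rightarrow> bool" where
  "psd P \<longleftrightarrow> P \<in> SymM \<and> (\<forall>\<xi>. 0 \<le> \<xi> \<bullet> (P *v \<xi>))"

definition RS :: "(real \<times> (real^'n^'n)) set" where
  "RS = UNIV \<times> SymM"

definition Qcone :: "(real \<times> (real^'n^'n)) set" where
  "Qcone = {(s, P). s \<le> 0 \<and> psd P}"

definition proper_elliptic_map ::
  "(real^'n) set \<Rightarrow> (real^'n \<Rightarrow> (real \<times> (real^'n^'n)) set) \<Rightarrow> bool" where
  "proper_elliptic_map \<Omega> \<Theta> \<longleftrightarrow>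
     (\<forall>x\<in>\<Omega>. \<Theta> x \<subseteq> RS \<and> \<Theta> x \<noteq> RS \<and> \<Theta> x \<noteq> {} \<and> closed (\<Theta> x) \<and>
        (\<forall>a\<in>\<Theta> x. \<forall>q\<in>Qcone. a + q \<in> \<Theta> x))"

definition C2_on_with ::
  "(real^'n) set \<Rightarrow> (real^'n \<Rightarrow> real) \<Rightarrow> (real^'n \<Rightarrow> real^'n) \<Rightarrow> (real^'n \<Rightarrow> real^'n^'n) \<Rightarrow> bool" where
  "C2_on_with U \<phi> g H \<longleftrightarrow> open U \<and>
     (\<forall>x\<in>U. (\<phi> has_derivative (\<lambda>h. g x \<bullet> h)) (at x) \<and>
             (g has_derivative (\<lambda>h. H x *v h)) (at x)) \<and>
     continuous_on U H"

definition Jplus :: "(real^'n \<Rightarrow> real) \<Rightarrow> real^'n \<Rightarrow> (real \<times> (real^'n^'n)) set" where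
  "Jplus u x0 = {(\<phi> x0, H x0) | \<phi> g H. \<exists>U. x0 \<in> U \<and> C2_on_with U \<phi> g H \<and>
       (\<forall>x\<in>U. u x \<le> \<phi> x) \<and> u x0 = \<phi> x0}"

definition Jminus :: "(real^'n \<Rightarrow> real) \<Rightarrow> real^'n \<Rightarrow> (real \<times> (real^'n^'n)) set" where
  "Jminus v x0 = {(\<phi> x0, H x0) | \<phi> g H. \<exists>U. x0 \<in> U \<and> C2_on_with U \<phi> g H \<and>
       (\<forall>x\<in>U. v x \<ge> \<phi> x) \<and> v x0 = \<phi> x0}"

definition usc_on :: "(real^'n) set \<Rightarrow> (real^'n \<Rightarrow> real) \<Rightarrow> bool" where
  "usc_on S u \<longleftrightarrow> (\<forall>t. openin (top_of_set S) {x\<in>S. u x < t})"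

definition lsc_on :: "(real^'n) set \<Rightarrow> (real^'n \<Rightarrow> real) \<Rightarrow> bool" where
  "lsc_on S v \<longleftrightarrow> (\<forall>t. openin (top_of_set S) {x\<in>S. v x > t})"

definition Theta_subharmonic ::
  "(real^'n \<Rightarrow> (real \<times> (real^'n^'n)) set) \<Rightarrow> (real^'n) set \<Rightarrow> (real^'n \<Rightarrow> real) \<Rightarrow> bool" where
  "Theta_subharmonic \<Theta> \<Omega> u \<longleftrightarrow> (\<forall>x0\<in>\<Omega>. Jplus u x0 \<subseteq> \<Theta> x0)"

definition Theta_superharmonic ::
  "(real^'n \<Rightarrow> (real \<times> (real^'n^'n)) set) \<Rightarrow> (real^'n) set \<Rightarrow> (real^'n \<Rightarrow> real) \<Rightarrow> bool" where
  "Theta_superharmonic \<Theta> \<Omega> v \<longleftrightarrow>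
     (\<forall>x0\<in>\<Omega>. Jminus v x0 \<subseteq> RS - ((top_of_set RS) interior_of (\<Theta> x0)))"

definition compactly_contained :: "(real^'n) set \<Rightarrow> (real^'n) set \<Rightarrow> bool" where
  "compactly_contained X \<Omega> \<longleftrightarrow> compact (closure X) \<and> closure X \<subseteq> \<Omega>"

end

theory Submission
  imports Defs
begin

text \<open>
  If \<open>u > v\<close> somewhere, replace \<open>u\<close> by \<open>u + \<kappa> (|x|\<^sup>2 - \<rho>\<^sup>2) / 2\<close>, which is strictly subharmonic, and let
  \<open>u\<^sup>k\<close> and \<open>v\<^sub>k\<close> be the sup- and inf-convolutions with opening \<open>k\<close>. The Lasry--Lions
  regularization \<open>f\<close> of \<open>u\<close> is \<open>C\<^bsup>1,1\<^esup>\<close> and satisfies \<open>u\<^sup>k \<le> f \<le> v\<^sub>k + l\<close> simultaneously for all affine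
  \<open>l\<close> of small slope with \<open>u\<^sup>k \<le> v\<^sub>k + l\<close>. The contact points of \<open>u\<^sup>k\<close> and \<open>v\<^sub>k + l\<close>, as the slope of \<open>l\<close>
  ranges over a ball, do not form a null set, because the slope is a Lipschitz function of the
  contact point. By Rademacher's theorem for the gradient of \<open>f\<close> there is a contact point at which
  \<open>f\<close> has a second-order expansion; translates of it are test functions for \<open>u\<close> at some \<open>y\<close> and for
  \<open>v\<close> at a nearby \<open>z\<close> with almost the same Hessian, which contradicts the continuity of \<open>\<Theta>\<close>.

  Only expansions up to an error \<open>\<tau>\<close> are needed, and these are obtained without integration by
  parts: one-dimensional differentiability follows from the Vitali covering theorem, and at a
  density point of a set on which the partial difference quotients are uniformly close to
  constants the increments along the coordinate axes add up.
\<close>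

section \<open>Density and differentiability almost everywhere\<close>

lemma negligible_density_less_one_finite:
  fixes S :: "'a::euclidean_space set"
  assumes S: "S \<in> lmeasurable" and \<theta>: "0 \<le> \<theta>" "\<theta> < 1"
    and dens: "\<And>x d. x \<in> S \<Longrightarrow> 0 < d \<Longrightarrow> \<exists>a r. 0 < r \<and> r < d \<and> x \<in> ball a r \<and>
      emeasure lebesgue (S \<inter> ball a r) \<le> ennreal \<theta> * emeasure lebesgue (ball a r)"
  shows "negligible S"
proof -
  have SL: "S \<in> sets lebesgue" using S by auto
  have key: "measure lebesgue S \<le> \<theta> * (measure lebesgue S + e)" if "e > 0" for e
  proof -
    obtain T where T: "open T" "S \<subseteq> T" "(T - S) \<in> lmeasurable" "emeasure lebesgue (T - S) < ennreal e"
      using sets_lebesgue_outer_open[OF SL \<open>e > 0\<close>] by blast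
    define K where "K = {(a::'a, r). 0 < r \<and> ball a r \<subseteq> T \<and>
      emeasure lebesgue (S \<inter> ball a r) \<le> ennreal \<theta> * emeasure lebesgue (ball a r)}"
    have cover: "\<exists>i. i \<in> K \<and> x \<in> ball (fst i) (snd i) \<and> snd i < d" if x: "x \<in> S" "0 < d" for x d
    proof -
      obtain \<epsilon> where \<epsilon>: "\<epsilon> > 0" "ball x \<epsilon> \<subseteq> T" using T x open_contains_ball by blast
      obtain a r where ar: "0 < r" "r < min d (\<epsilon>/2)" "x \<in> ball a r"
        "emeasure lebesgue (S \<inter> ball a r) \<le> ennreal \<theta> * emeasure lebesgue (ball a r)"
        using dens[OF x(1), of "min d (\<epsilon>/2)"] x \<epsilon> by auto
      have "ball a r \<subseteq> ball x \<epsilon>"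
      proof
        fix y assume "y \<in> ball a r"
        then have "dist x y \<le> 2 * r" using ar(3) dist_triangle3[of x y a] by (simp add: dist_commute)
        then show "y \<in> ball x \<epsilon>" using ar by auto
      qed
      then have "(a, r) \<in> K" using ar \<epsilon> by (auto simp: K_def)
      then show ?thesis using ar by (intro exI[of _ "(a, r)"]) auto
    qed
    obtain C where C: "countable C" "C \<subseteq> K"
     "pairwise (\<lambda>i j. disjnt (ball (fst i) (snd i)) (ball (fst j) (snd j))) C"
     "negligible (S - (\<Union>i \<in> C. ball (fst i) (snd i)))"
      by (rule Vitali_covering_theorem_balls[of S K fst snd]) (use cover in auto)
    have dj: "disjoint_family_on (\<lambda>i. ball (fst i) (snd i)) C"
      using C(3) unfolding disjoint_family_on_def pairwise_def disjnt_def by blast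
    have dj': "disjoint_family_on (\<lambda>i. S \<inter> ball (fst i) (snd i)) C"
      using dj unfolding disjoint_family_on_def by blast
    let ?N = "S - (\<Union>i \<in> C. ball (fst i) (snd i))"
    have "emeasure lebesgue S \<le> emeasure lebesgue (?N \<union> (\<Union>i \<in> C. S \<inter> ball (fst i) (snd i)))"
      using C(1) SL by (intro emeasure_mono sets.Un sets.Diff sets.countable_UN') auto
    also have "\<dots> \<le> emeasure lebesgue ?N + emeasure lebesgue (\<Union>i \<in> C. S \<inter> ball (fst i) (snd i))"
      using C(1) SL by (intro emeasure_subadditive sets.Diff sets.countable_UN') auto
    also have "\<dots> = emeasure lebesgue (\<Union>i \<in> C. S \<inter> ball (fst i) (snd i))"
      using C(4) negligible_iff_emeasure0[of ?N] negligible_imp_sets by fastforce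
    also have "\<dots> = (\<integral>\<^sup>+ i. emeasure lebesgue (S \<inter> ball (fst i) (snd i)) \<partial>count_space C)"
      using C dj' SL by (intro emeasure_UN_countable) auto
    also have "\<dots> \<le> (\<integral>\<^sup>+ i. ennreal \<theta> * emeasure lebesgue (ball (fst i) (snd i)) \<partial>count_space C)"
      using C(2) by (intro nn_integral_mono) (auto simp: K_def)
    also have "\<dots> = ennreal \<theta> * (\<integral>\<^sup>+ i. emeasure lebesgue (ball (fst i) (snd i)) \<partial>count_space C)"
      by (rule nn_integral_cmult) auto
    also have "(\<integral>\<^sup>+ i. emeasure lebesgue (ball (fst i) (snd i)) \<partial>count_space C)
        = emeasure lebesgue (\<Union>i \<in> C. ball (fst i) (snd i))"
      using C dj by (intro emeasure_UN_countable[symmetric]) auto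
    also have "\<dots> \<le> emeasure lebesgue T"
      using C(2) T(1) by (intro emeasure_mono) (auto simp: K_def subset_iff)
    also have "emeasure lebesgue T \<le> emeasure lebesgue S + emeasure lebesgue (T - S)"
      using emeasure_subadditive[of S lebesgue "T - S"] SL T by (auto simp: Un_absorb1)
    also have "\<dots> \<le> emeasure lebesgue S + ennreal e" using T by (intro add_left_mono) auto
    also have "emeasure lebesgue S = ennreal (measure lebesgue S)" 
      using S by (simp add: emeasure_eq_measure2)
    finally have "ennreal (measure lebesgue S) \<le> ennreal (\<theta> * (measure lebesgue S + e))"
      using \<open>e > 0\<close> \<theta> by (simp add: ennreal_mult' mult_left_mono flip: ennreal_plus)
    then show ?thesis using \<theta> \<open>e>0\<close> by (subst (asm) ennreal_le_iff) auto
  qed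
  have "measure lebesgue S = 0"
  proof (rule ccontr)
    assume "measure lebesgue S \<noteq> 0"
    then have m: "measure lebesgue S > 0" by (simp add: less_le)
    have "measure lebesgue S * 1 \<le> measure lebesgue S * (\<theta> * (2 - \<theta>))"
      using key[of "measure lebesgue S * (1 - \<theta>)"] m \<theta> by (simp add: algebra_simps)
    then have "1 \<le> \<theta> * (2 - \<theta>)" using m by (simp only: mult_le_cancel_left_pos)
    moreover have "(1 - \<theta>) * (1 - \<theta>) > 0" using \<theta> by simp
    ultimately show False by (simp add: algebra_simps)
  qed
  then show ?thesis using S negligible_iff_measure by blast
qed

lemma negligible_density_less_one:
  fixes S :: "'a::euclidean_space set"
  assumes S: "S \<in> sets lebesgue" and \<theta>: "0 \<le> \<theta>" "\<theta> < 1"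
    and dens: "\<And>x d. x \<in> S \<Longrightarrow> 0 < d \<Longrightarrow> \<exists>a r. 0 < r \<and> r < d \<and> x \<in> ball a r \<and>
      emeasure lebesgue (S \<inter> ball a r) \<le> ennreal \<theta> * emeasure lebesgue (ball a r)"
  shows "negligible S"
proof -
  have "negligible (S \<inter> cball 0 (real n))" for n
  proof (rule negligible_density_less_one_finite[OF _ \<theta>])
    show "S \<inter> cball 0 (real n) \<in> lmeasurable"
      using S by (intro bounded_set_imp_lmeasurable) auto
    fix x :: 'a and d :: real assume "x \<in> S \<inter> cball 0 (real n)" "0 < d"
    then obtain a r where ar: "0 < r" "r < d" "x \<in> ball a r"
      "emeasure lebesgue (S \<inter> ball a r) \<le> ennreal \<theta> * emeasure lebesgue (ball a r)"
      using dens[of x d] by auto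
    have "emeasure lebesgue (S \<inter> cball 0 (real n) \<inter> ball a r) \<le> emeasure lebesgue (S \<inter> ball a r)"
      using S by (intro emeasure_mono) auto
    then show "\<exists>a r. 0 < r \<and> r < d \<and> x \<in> ball a r \<and>
       emeasure lebesgue (S \<inter> cball 0 (real n) \<inter> ball a r) \<le> ennreal \<theta> * emeasure lebesgue (ball a r)"
      using ar order_trans by blast
  qed
  then have "negligible (\<Union>n. S \<inter> cball 0 (real n))" by (intro negligible_countable_Union) auto
  moreover have "S \<subseteq> (\<Union>n. S \<inter> cball 0 (real n))" using real_arch_simple by auto
  ultimately show ?thesis using negligible_subset by blast
qed

lemma mono_large_slope_measure:
  fixes \<psi> :: "real \<Rightarrow> real"
  assumes mono: "mono \<psi>" and A: "A \<in> sets lebesgue" "A \<subseteq> {a<..<b}" and q: "0 \<le> q" and ab: "a \<le> b"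
    and slope: "\<And>x d. x \<in> A \<Longrightarrow> 0 < d \<Longrightarrow> \<exists>s t. s < t \<and> t - s < d \<and> s \<le> x \<and> x \<le> t \<and>
      q * (t - s) \<le> \<psi> t - \<psi> s"
  shows "q * measure lebesgue A \<le> \<psi> b - \<psi> a"
proof -
  define K where "K = {(s, t). s < t \<and> a \<le> s \<and> t \<le> b \<and> q * (t - s) \<le> \<psi> t - \<psi> s}"
  define c where "c = (\<lambda>(s, t). (s + t) / 2 :: real)"
  define r where "r = (\<lambda>(s, t). (t - s) / 2 :: real)"
  have cb: "cball (c i) (r i) = {fst i..snd i}" for i
    by (auto simp: c_def r_def cball_eq_atLeastAtMost field_simps split: prod.splits)
  have cover: "\<exists>i. i \<in> K \<and> x \<in> cball (c i) (r i) \<and> r i < d" if x: "x \<in> A" "0 < d" for x d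
  proof -
    have "a < x" "x < b" using x A by auto
    then obtain s t where st: "s < t" "t - s < min d (min (x - a) (b - x))" "s \<le> x" "x \<le> t"
      "q * (t - s) \<le> \<psi> t - \<psi> s"
      using slope[OF x(1), of "min d (min (x - a) (b - x))"] x by auto
    then have "(s, t) \<in> K" by (auto simp: K_def)
    moreover have "x \<in> cball (c (s,t)) (r (s,t))" unfolding cb using st by auto
    ultimately show ?thesis using st by (intro exI[of _ "(s, t)"]) (auto simp: r_def)
  qed
  have pos: "0 < r i" if "i \<in> K" for i using that by (auto simp: K_def r_def)
  obtain C where C: "countable C" "C \<subseteq> K"
     "pairwise (\<lambda>i j. disjnt (cball (c i) (r i)) (cball (c j) (r j))) C"
     "negligible (A - (\<Union>i \<in> C. cball (c i) (r i)))"
    by (rule Vitali_covering_theorem_cballs[of K r A c]) (use pos cover in auto)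
  have fin: "emeasure lebesgue A < \<infinity>"
    using emeasure_mono[of A "{a<..<b}" lebesgue] A ab
    by (auto simp: less_top[symmetric] top_unique)
  let ?N = "A - (\<Union>i \<in> C. {fst i..snd i})"
  have N: "negligible ?N" using C(4) by (simp add: cb)
  have "emeasure lebesgue A \<le> emeasure lebesgue (?N \<union> (\<Union>i \<in> C. {fst i..snd i}))"
    using C(1) A by (intro emeasure_mono sets.Un sets.Diff sets.countable_UN') auto
  also have "\<dots> \<le> emeasure lebesgue ?N + emeasure lebesgue (\<Union>i \<in> C. {fst i..snd i})"
    using C(1) A by (intro emeasure_subadditive sets.Un sets.Diff sets.countable_UN') auto
  also have "\<dots> = emeasure lebesgue (\<Union>i \<in> C. {fst i..snd i})"
    using N negligible_iff_emeasure0[of ?N] negligible_imp_sets by fastforce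
  also have "\<dots> = (\<integral>\<^sup>+ i. emeasure lebesgue {fst i..snd i} \<partial>count_space C)"
    using C(1,3) by (intro emeasure_UN_countable)
      (auto simp: cb disjoint_family_on_def pairwise_def disjnt_def)
  finally have "ennreal q * emeasure lebesgue A \<le>
      ennreal q * (\<integral>\<^sup>+ i. emeasure lebesgue {fst i..snd i} \<partial>count_space C)" by (rule mult_left_mono) simp
  also have "\<dots> = (\<integral>\<^sup>+ i. ennreal q * emeasure lebesgue {fst i..snd i} \<partial>count_space C)"
    by (rule nn_integral_cmult[symmetric]) auto
  also have "\<dots> \<le> (\<integral>\<^sup>+ i. emeasure lebesgue {\<psi> (fst i)<..<\<psi> (snd i)} \<partial>count_space C)"
  proof (rule nn_integral_mono, simp)
    fix i assume "i \<in> C"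
    then have "i \<in> K" using C by auto
    then have *: "fst i < snd i" "q * (snd i - fst i) \<le> \<psi> (snd i) - \<psi> (fst i)" by (auto simp: K_def)
    moreover have "0 \<le> q * (snd i - fst i)" using q * by simp
    moreover from calculation have "\<psi> (fst i) \<le> \<psi> (snd i)" by linarith
    ultimately show "ennreal q * emeasure lborel {fst i..snd i} \<le> emeasure lborel {\<psi> (fst i)<..<\<psi> (snd i)}"
      using q by (simp add: ennreal_mult'[symmetric])
  qed
  also have "\<dots> = emeasure lebesgue (\<Union>i \<in> C. {\<psi> (fst i)<..<\<psi> (snd i)})"
  proof (rule emeasure_UN_countable[symmetric])
    show "disjoint_family_on (\<lambda>i. {\<psi> (fst i)<..<\<psi> (snd i)}) C"
      unfolding disjoint_family_on_def
    proof (intro ballI impI)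
      fix i j assume ij: "i \<in> C" "j \<in> C" "i \<noteq> j"
      then have "{fst i..snd i} \<inter> {fst j..snd j} = {}" "fst i < snd i" "fst j < snd j"
        using C by (auto simp: cb pairwise_def disjnt_def K_def)
      then have "snd i < fst j \<or> snd j < fst i" by force
      then have "\<psi> (snd i) \<le> \<psi> (fst j) \<or> \<psi> (snd j) \<le> \<psi> (fst i)" using monoD[OF mono] less_imp_le by meson
      then show "{\<psi> (fst i)<..<\<psi> (snd i)} \<inter> {\<psi> (fst j)<..<\<psi> (snd j)} = {}" by auto
    qed
  qed (use C in auto)
  also have "\<dots> \<le> emeasure lebesgue {\<psi> a..\<psi> b}"
  proof (rule emeasure_mono)
    show "(\<Union>i \<in> C. {\<psi> (fst i)<..<\<psi> (snd i)}) \<subseteq> {\<psi> a..\<psi> b}"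
    proof clarsimp
      fix s t x assume "(s, t) \<in> C" "\<psi> s < x" "x < \<psi> t"
      moreover from this C have "a \<le> s" "t \<le> b" by (auto simp: K_def)
      ultimately show "\<psi> a \<le> x \<and> x \<le> \<psi> b"
        using monoD[OF mono, of a s] monoD[OF mono, of t b] by auto
    qed
  qed simp
  also have "\<dots> = ennreal (\<psi> b - \<psi> a)" using monoD[OF mono ab] by simp
  also have "emeasure lebesgue A = ennreal (measure lebesgue A)"
    using fin by (intro emeasure_eq_ennreal_measure) auto
  finally show ?thesis using q monoD[OF mono ab] by (simp add: ennreal_mult'[symmetric])
qed

lemma lipschitz_large_slope_measure:
  fixes \<phi> :: "real \<Rightarrow> real"
  assumes L: "\<And>x y. \<bar>\<phi> x - \<phi> y\<bar> \<le> L * \<bar>x - y\<bar>" and A: "A \<in> sets lebesgue" "A \<subseteq> {a<..<b}" and ab: "a \<le> b"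
    and slope: "\<And>x d. x \<in> A \<Longrightarrow> 0 < d \<Longrightarrow> \<exists>t. t \<noteq> 0 \<and> \<bar>t\<bar> < d \<and> q < (\<phi> (x + t) - \<phi> x) / t"
  shows "(q + L) * measure lebesgue A \<le> \<phi> b - \<phi> a + L * (b - a)"
proof -
  define \<psi> where "\<psi> x = \<phi> x + L * x" for x
  have mono: "mono \<psi>"
  proof (rule monoI)
    fix x y :: real assume "x \<le> y"
    then show "\<psi> x \<le> \<psi> y" using L[of x y] by (auto simp: \<psi>_def algebra_simps abs_if split: if_splits)
  qed
  show ?thesis
  proof (cases "q + L \<ge> 0")
    case True
    have "(q + L) * measure lebesgue A \<le> \<psi> b - \<psi> a"
    proof (rule mono_large_slope_measure[OF mono A True ab])
      fix x d :: real assume "x \<in> A" "0 < d"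
      then obtain t where t: "t \<noteq> 0" "\<bar>t\<bar> < d" "q < (\<phi> (x + t) - \<phi> x) / t" using slope by blast
      show "\<exists>s t. s < t \<and> t - s < d \<and> s \<le> x \<and> x \<le> t \<and> (q + L) * (t - s) \<le> \<psi> t - \<psi> s"
      proof (cases "t > 0")
        case True
        then have "q * t < \<phi> (x + t) - \<phi> x" using t by (simp add: pos_less_divide_eq)
        then show ?thesis using t True by (intro exI[of _ x] exI[of _ "x + t"]) (auto simp: \<psi>_def algebra_simps)
      next
        case False
        then have "q * t > \<phi> (x + t) - \<phi> x" using t by (simp add: neg_less_divide_eq)
        then show ?thesis using t False by (intro exI[of _ "x + t"] exI[of _ x]) (auto simp: \<psi>_def algebra_simps)
      qed
    qed
    then show ?thesis by (simp add: \<psi>_def algebra_simps)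
  next
    case False
    then have "(q + L) * measure lebesgue A \<le> 0" by (intro mult_nonpos_nonneg) auto
    then show ?thesis using monoD[OF mono ab] by (simp add: \<psi>_def algebra_simps)
  qed
qed

lemma lipschitz_oscillating_slope_negligible:
  fixes \<phi> :: "real \<Rightarrow> real"
  assumes L: "\<And>x y. \<bar>\<phi> x - \<phi> y\<bar> \<le> L * \<bar>x - y\<bar>" and pq: "p < q"
  shows "negligible {x. \<forall>n::nat. (\<exists>t. t \<noteq> 0 \<and> \<bar>t\<bar> < 1 / Suc n \<and> q < (\<phi> (x + t) - \<phi> x) / t) \<and>
    (\<exists>t. t \<noteq> 0 \<and> \<bar>t\<bar> < 1 / Suc n \<and> (\<phi> (x + t) - \<phi> x) / t < p)}" (is "negligible ?A")
proof -
  have L0: "L \<ge> 0" using L[of 0 1] by simp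
  have cont: "continuous_on UNIV \<phi>"
    using L L0 by (intro lipschitz_on_continuous_on[of L]) (auto simp: dist_real_def lipschitz_on_def)
  have A: "?A \<in> sets lebesgue"
  proof -
    have cs: "continuous_on UNIV (\<lambda>x. (\<phi> (x + t) - \<phi> x) / t)" for t
      unfolding divide_inverse by (intro continuous_intros continuous_on_compose2[OF cont]) auto
    have op: "open {x. \<exists>t. t \<noteq> 0 \<and> \<bar>t\<bar> < 1 / Suc n \<and> q < (\<phi> (x + t) - \<phi> x) / t}"
       "open {x. \<exists>t. t \<noteq> 0 \<and> \<bar>t\<bar> < 1 / Suc n \<and> (\<phi> (x + t) - \<phi> x) / t < p}" for n :: nat
      by (intro open_Collect_ex open_Collect_conj open_Collect_const open_Collect_less cs continuous_on_const)+
    have "?A = (\<Inter>n. {x. \<exists>t. t \<noteq> 0 \<and> \<bar>t\<bar> < 1 / Suc n \<and> q < (\<phi> (x + t) - \<phi> x) / t} \<inter>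
      {x. \<exists>t. t \<noteq> 0 \<and> \<bar>t\<bar> < 1 / Suc n \<and> (\<phi> (x + t) - \<phi> x) / t < p})" by blast
    also have "\<dots> \<in> sets borel" using op by (intro sets.countable_INT'' sets.Int borel_open) auto
    finally show ?thesis by auto
  qed
  have freq: "\<exists>t. t \<noteq> 0 \<and> \<bar>t\<bar> < d \<and> q < (\<phi> (x + t) - \<phi> x) / t"
     "\<exists>t. t \<noteq> 0 \<and> \<bar>t\<bar> < d \<and> (\<phi> (x + t) - \<phi> x) / t < p" if "x \<in> ?A" "d > 0" for x d
  proof -
    obtain n where n: "1 / Suc n < d" using nat_approx_posE[OF \<open>d > 0\<close>] by blast
    have "\<exists>t. t \<noteq> 0 \<and> \<bar>t\<bar> < 1 / Suc n \<and> q < (\<phi> (x + t) - \<phi> x) / t"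
      "\<exists>t. t \<noteq> 0 \<and> \<bar>t\<bar> < 1 / Suc n \<and> (\<phi> (x + t) - \<phi> x) / t < p" using that(1) by blast+
    then show "\<exists>t. t \<noteq> 0 \<and> \<bar>t\<bar> < d \<and> q < (\<phi> (x + t) - \<phi> x) / t"
     "\<exists>t. t \<noteq> 0 \<and> \<bar>t\<bar> < d \<and> (\<phi> (x + t) - \<phi> x) / t < p"
      using n by (meson order.strict_trans)+
  qed
  define \<theta> where "\<theta> = 2 * L / (2 * L + (q - p))"
  have \<theta>: "0 \<le> \<theta>" "\<theta> < 1" using L0 pq by (auto simp: \<theta>_def field_simps)
  show ?thesis
  proof (rule negligible_density_less_one[OF A \<theta>])
    fix x d :: real assume "x \<in> ?A" "0 < d"
    define r where "r = d / 2"
    have r: "0 < r" "r < d" using \<open>0 < d\<close> by (auto simp: r_def)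
    let ?B = "?A \<inter> ball x r"
    have B: "?B \<in> sets lebesgue" "?B \<subseteq> {x - r <..< x + r}" using A by (auto simp: dist_real_def)
    have 1: "(q + L) * measure lebesgue ?B \<le> \<phi> (x + r) - \<phi> (x - r) + L * (x + r - (x - r))"
    proof (rule lipschitz_large_slope_measure[OF L B])
      show "\<exists>t. t \<noteq> 0 \<and> \<bar>t\<bar> < d' \<and> q < (\<phi> (x' + t) - \<phi> x') / t" if "x' \<in> ?B" "0 < d'" for x' d'
        using freq(1)[OF IntD1[OF that(1)] that(2)] .
    qed (use r in auto)
    have 2: "(- p + L) * measure lebesgue ?B \<le> - \<phi> (x + r) - (- \<phi> (x - r)) + L * (x + r - (x - r))"
    proof (rule lipschitz_large_slope_measure[OF _ B, of "\<lambda>x. - \<phi> x"])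
      show "\<bar>- \<phi> x - - \<phi> y\<bar> \<le> L * \<bar>x - y\<bar>" for x y using L[of x y] by (simp add: abs_minus_commute)
      fix x' d' :: real assume xd: "x' \<in> ?B" "0 < d'"
      have "\<exists>t. t \<noteq> 0 \<and> \<bar>t\<bar> < d' \<and> (\<phi> (x' + t) - \<phi> x') / t < p"
        by (rule freq(2)[OF IntD1[OF xd(1)] xd(2)])
      then obtain t where "t \<noteq> 0" "\<bar>t\<bar> < d'" "(\<phi> (x' + t) - \<phi> x') / t < p" by blast
      then show "\<exists>t. t \<noteq> 0 \<and> \<bar>t\<bar> < d' \<and> - p < (- \<phi> (x' + t) - - \<phi> x') / t"
        by (intro exI[of _ t]) (auto simp: diff_divide_distrib)
    qed (use r in auto)
    have "(2 * L + (q - p)) * measure lebesgue ?B \<le> 2 * L * (2 * r)"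
      using 1 2 by (simp add: algebra_simps)
    then have m: "measure lebesgue ?B \<le> \<theta> * (2 * r)"
      using L0 pq by (simp add: \<theta>_def field_simps)
    have "?B \<in> lmeasurable" using A by (intro bounded_set_imp_lmeasurable) auto
    then have "emeasure lebesgue ?B = ennreal (measure lebesgue ?B)" by (simp add: emeasure_eq_measure2)
    also have "\<dots> \<le> ennreal (\<theta> * (2 * r))" using m by (rule ennreal_leI)
    also have "\<dots> = ennreal \<theta> * emeasure lebesgue (ball x r)"
      using \<theta> r by (simp add: ennreal_mult' ball_eq_greaterThanLessThan)
    finally show "\<exists>a r. 0 < r \<and> r < d \<and> x \<in> ball a r \<and>
      emeasure lebesgue (?A \<inter> ball a r) \<le> ennreal \<theta> * emeasure lebesgue (ball a r)"
      using r by (intro exI[of _ x] exI[of _ r]) auto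
  qed
qed

lemma lipschitz_approx_derivative_ae_real:
  fixes \<phi> :: "real \<Rightarrow> real"
  assumes L: "\<And>x y. \<bar>\<phi> x - \<phi> y\<bar> \<le> L * \<bar>x - y\<bar>" and \<tau>: "\<tau> > 0"
  shows "negligible {x. \<not> (\<exists>a\<in>\<rat>. \<exists>k::nat. \<forall>t. \<bar>t\<bar> < 1 / Suc k \<longrightarrow> \<bar>\<phi> (x + t) - \<phi> x - a * t\<bar> \<le> \<tau> * \<bar>t\<bar>)}"
proof -
  define F where "F x q \<longleftrightarrow> (\<forall>n::nat. \<exists>t. t \<noteq> 0 \<and> \<bar>t\<bar> < 1 / Suc n \<and> q < (\<phi> (x + t) - \<phi> x) / t)" for x q
  define G where "G x p \<longleftrightarrow> (\<forall>n::nat. \<exists>t. t \<noteq> 0 \<and> \<bar>t\<bar> < 1 / Suc n \<and> (\<phi> (x + t) - \<phi> x) / t < p)" for x p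
  have neg: "negligible {x. F x q \<and> G x p}" if "p < q" for p q
    using lipschitz_oscillating_slope_negligible[OF L that]
    by (simp add: F_def G_def all_conj_distrib)
  have sb: "\<bar>(\<phi> (x + t) - \<phi> x) / t\<bar> \<le> L" if "t \<noteq> 0" for x t
    using L[of "x + t" x] that by (simp add: field_simps)
  have "negligible (\<Union>(p, q) \<in> {(p, q). p \<in> \<rat> \<and> q \<in> \<rat> \<and> p < q}. {x. F x q \<and> G x p})"
  proof (rule negligible_countable_Union)
    have "countable (\<rat> \<times> \<rat> :: (real \<times> real) set)" using countable_rat by blast
    then have "countable {(p, q :: real). p \<in> \<rat> \<and> q \<in> \<rat> \<and> p < q}" by (rule countable_subset[rotated]) auto
    then show "countable ((\<lambda>(p, q). {x. F x q \<and> G x p}) ` {(p, q). p \<in> \<rat> \<and> q \<in> \<rat> \<and> p < q})" by blast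
  qed (use neg in auto)
  moreover have "{x. \<not> (\<exists>a\<in>\<rat>. \<exists>k::nat. \<forall>t. \<bar>t\<bar> < 1 / Suc k \<longrightarrow> \<bar>\<phi> (x + t) - \<phi> x - a * t\<bar> \<le> \<tau> * \<bar>t\<bar>)}
    \<subseteq> (\<Union>(p, q) \<in> {(p, q). p \<in> \<rat> \<and> q \<in> \<rat> \<and> p < q}. {x. F x q \<and> G x p})"
  proof (rule subsetI, rule ccontr)
    fix x assume x: "x \<in> {x. \<not> (\<exists>a\<in>\<rat>. \<exists>k::nat. \<forall>t. \<bar>t\<bar> < 1 / Suc k \<longrightarrow> \<bar>\<phi> (x + t) - \<phi> x - a * t\<bar> \<le> \<tau> * \<bar>t\<bar>)}"
      and nx: "x \<notin> (\<Union>(p, q) \<in> {(p, q). p \<in> \<rat> \<and> q \<in> \<rat> \<and> p < q}. {x. F x q \<and> G x p})"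
    have F0: "F x (- L - 1)" unfolding F_def
    proof
      fix n :: nat
      have "(1/2) / Suc n \<noteq> (0::real)" by simp
      from sb[OF this, of x] show "\<exists>t. t \<noteq> 0 \<and> \<bar>t\<bar> < 1 / real (Suc n) \<and> - L - 1 < (\<phi> (x + t) - \<phi> x) / t"
        by (intro exI[of _ "(1/2) / Suc n"]) (auto simp: divide_simps)
    qed
    have FL: "q \<le> L" if "F x q" for q
    proof -
      have "\<exists>t. t \<noteq> 0 \<and> \<bar>t\<bar> < 1 / real (Suc 0) \<and> q < (\<phi> (x + t) - \<phi> x) / t"
        using that unfolding F_def by (rule spec)
      then obtain t where "t \<noteq> 0" "q < (\<phi> (x + t) - \<phi> x) / t" by metis
      then show ?thesis using sb[of t x] by linarith
    qed
    define s where "s = Sup {q. F x q}"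
    have bdd: "bdd_above {q. F x q}" using FL by (auto simp: bdd_above_def)
    obtain q0 where q0: "F x q0" "q0 > s - \<tau> / 3"
      using less_cSupD[of "{q. F x q}" "s - \<tau> / 3"] F0 \<tau> by (auto simp: s_def)
    obtain q where q: "q \<in> \<rat>" "s - \<tau> / 3 < q" "q < q0" using Rats_dense_in_real[OF q0(2)] by blast
    obtain p where p: "p \<in> \<rat>" "s - \<tau> / 2 < p" "p < s - \<tau> / 3"
      using Rats_dense_in_real[of "s - \<tau> / 2" "s - \<tau> / 3"] \<tau> by auto
    obtain q' where q': "q' \<in> \<rat>" "s < q'" "q' < s + \<tau> / 4"
      using Rats_dense_in_real[of s "s + \<tau> / 4"] \<tau> by auto
    have "F x q" using q0(1) q(3) unfolding F_def by (meson order.strict_trans)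
    then have "\<not> G x p" using nx p q by fastforce
    then obtain n where n: "\<And>t. t \<noteq> 0 \<Longrightarrow> \<bar>t\<bar> < 1 / Suc n \<Longrightarrow> p \<le> (\<phi> (x + t) - \<phi> x) / t"
      unfolding G_def by (meson not_less)
    have "\<not> F x q'" using cSup_upper[OF _ bdd, of q'] q' by (auto simp: s_def)
    then obtain m where m: "\<And>t. t \<noteq> 0 \<Longrightarrow> \<bar>t\<bar> < 1 / Suc m \<Longrightarrow> (\<phi> (x + t) - \<phi> x) / t \<le> q'"
      unfolding F_def by (meson not_less)
    have "\<bar>\<phi> (x + t) - \<phi> x - q' * t\<bar> \<le> \<tau> * \<bar>t\<bar>" if t: "\<bar>t\<bar> < 1 / Suc (max n m)" for t
    proof (cases "t = 0")
      case False
      have "1 / real (Suc (max n m)) \<le> 1 / Suc n" "1 / real (Suc (max n m)) \<le> 1 / Suc m"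
        by (auto simp: field_simps)
      then have "p \<le> (\<phi> (x + t) - \<phi> x) / t" "(\<phi> (x + t) - \<phi> x) / t \<le> q'" using n[OF False] m[OF False] t by auto
      then have "\<bar>(\<phi> (x + t) - \<phi> x) / t - q'\<bar> \<le> \<tau>" using p q' \<tau> by (simp add: abs_if)
      then have "\<bar>(\<phi> (x + t) - \<phi> x) / t - q'\<bar> * \<bar>t\<bar> \<le> \<tau> * \<bar>t\<bar>" by (rule mult_right_mono) simp
      moreover have "((\<phi> (x + t) - \<phi> x) / t - q') * t = \<phi> (x + t) - \<phi> x - q' * t"
        using False by (simp add: field_simps)
      ultimately show ?thesis by (simp add: abs_mult[symmetric])
    qed simp
    then show False using x q' by blast
  qed
  ultimately show ?thesis by (rule negligible_subset)
qed

lemma negligible_lines: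
  fixes B :: "'a::euclidean_space set"
  assumes B: "B \<in> sets borel" and neg: "\<And>x. negligible {t::real. x + t *\<^sub>R e \<in> B}"
  shows "negligible B"
proof -
  have Bm[measurable]: "B \<in> sets borel" by fact
  have "(\<integral>\<^sup>+ t. (\<integral>\<^sup>+ x. indicator B (x + t *\<^sub>R e) \<partial>(lborel::'a measure)) \<partial>(lborel::real measure))
     = (\<integral>\<^sup>+ x. (\<integral>\<^sup>+ t. indicator B (x + t *\<^sub>R e) \<partial>(lborel::real measure)) \<partial>(lborel::'a measure))"
    by (rule lborel_pair.Fubini') measurable
  also have "\<dots> = (\<integral>\<^sup>+ x. 0 \<partial>(lborel::'a measure))"
  proof (rule nn_integral_cong)
    fix x :: 'a
    have m: "{t::real. x + t *\<^sub>R e \<in> B} \<in> sets borel" by measurable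
    have "(\<integral>\<^sup>+ t. indicator B (x + t *\<^sub>R e) \<partial>(lborel::real measure))
      = (\<integral>\<^sup>+ t. indicator {t. x + t *\<^sub>R e \<in> B} t \<partial>lborel)" by (intro nn_integral_cong) (auto simp: indicator_def)
    also have "\<dots> = emeasure lborel {t. x + t *\<^sub>R e \<in> B}" using m by simp
    also have "\<dots> = 0"
      using neg[of x] m by (simp add: negligible_iff_emeasure0)
    finally show "(\<integral>\<^sup>+ t. indicator B (x + t *\<^sub>R e) \<partial>(lborel::real measure)) = 0" .
  qed
  finally have 0: "(\<integral>\<^sup>+ t. (\<integral>\<^sup>+ x. indicator B (x + t *\<^sub>R e) \<partial>(lborel::'a measure)) \<partial>(lborel::real measure)) = 0" by simp
  have "(\<integral>\<^sup>+ x. indicator B (x + t *\<^sub>R e) \<partial>(lborel::'a measure)) = emeasure lborel B" for t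
  proof -
    have "emeasure lborel B = (\<integral>\<^sup>+ x. indicator B x \<partial>distr lborel borel ((+) (t *\<^sub>R e)))"
      by (simp add: lborel_distr_plus)
    also have "\<dots> = (\<integral>\<^sup>+ x. indicator B (x + t *\<^sub>R e) \<partial>lborel)"
      by (subst nn_integral_distr) (auto simp: add.commute)
    finally show ?thesis by simp
  qed
  with 0 have "emeasure lborel B * \<infinity> = 0" by simp
  then have "emeasure lborel B = 0" by (auto simp: ennreal_mult_eq_top_iff ennreal_top_mult split: if_splits)
  then show ?thesis using B by (simp add: negligible_iff_emeasure0)
qed

lemma lipschitz_approx_directional_derivative_ae:
  fixes \<phi> :: "'a::euclidean_space \<Rightarrow> real"
  assumes L0: "0 \<le> L" and L: "\<And>x y. \<bar>\<phi> x - \<phi> y\<bar> \<le> L * norm (x - y)" and \<tau>: "\<tau> > 0"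
  shows "negligible {x. \<not> (\<exists>a\<in>\<rat>. \<exists>k::nat. \<forall>t. \<bar>t\<bar> < 1 / Suc k \<longrightarrow>
    \<bar>\<phi> (x + t *\<^sub>R e) - \<phi> x - a * t\<bar> \<le> \<tau> * \<bar>t\<bar>)}" (is "negligible ?B")
proof (rule negligible_lines)
  have cont: "continuous_on UNIV \<phi>"
    using L L0 by (intro lipschitz_on_continuous_on[of L]) (auto simp: dist_real_def dist_norm lipschitz_on_def)
  have cl: "closed {x. \<forall>t. \<bar>t\<bar> < 1 / Suc k \<longrightarrow> \<bar>\<phi> (x + t *\<^sub>R e) - \<phi> x - a * t\<bar> \<le> \<tau> * \<bar>t\<bar>}" for a and k :: nat
    by (intro closed_Collect_all closed_Collect_imp open_Collect_const closed_Collect_le continuous_intros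
      continuous_on_compose2[OF cont]) auto
  have "(\<Union>a\<in>\<rat>. \<Union>k::nat. {x. \<forall>t. \<bar>t\<bar> < 1 / Suc k \<longrightarrow> \<bar>\<phi> (x + t *\<^sub>R e) - \<phi> x - a * t\<bar> \<le> \<tau> * \<bar>t\<bar>}) \<in> sets borel"
    using cl countable_rat by (intro sets.countable_UN' sets.countable_UN) (auto intro: borel_closed)
  then have "- (\<Union>a\<in>\<rat>. \<Union>k::nat. {x. \<forall>t. \<bar>t\<bar> < 1 / Suc k \<longrightarrow> \<bar>\<phi> (x + t *\<^sub>R e) - \<phi> x - a * t\<bar> \<le> \<tau> * \<bar>t\<bar>}) \<in> sets borel"
    using borel_comp by blast
  also have "- (\<Union>a\<in>\<rat>. \<Union>k::nat. {x. \<forall>t. \<bar>t\<bar> < 1 / Suc k \<longrightarrow> \<bar>\<phi> (x + t *\<^sub>R e) - \<phi> x - a * t\<bar> \<le> \<tau> * \<bar>t\<bar>}) = ?B"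
    by blast
  finally show "?B \<in> sets borel" .
  fix x
  have "\<bar>\<phi> (x + s *\<^sub>R e) - \<phi> (x + t *\<^sub>R e)\<bar> \<le> (L * norm e) * \<bar>s - t\<bar>" for s t
    using L[of "x + s *\<^sub>R e" "x + t *\<^sub>R e"] by (simp add: scaleR_diff_left[symmetric] mult_ac)
  from lipschitz_approx_derivative_ae_real[OF this \<tau>]
  show "negligible {t. x + t *\<^sub>R e \<in> ?B}" by (simp add: scaleR_add_left add.assoc)
qed

lemma closed_porous_points_negligible:
  fixes S :: "'a::euclidean_space set"
  assumes S: "closed S"
  shows "negligible {x\<in>S. \<exists>\<sigma>>0. \<forall>d>0. \<exists>y. dist x y < d \<and> \<sigma> * dist x y < infdist y S}"
proof -
  define P where "P n = {x\<in>S. \<forall>k::nat. \<exists>y. dist x y < 1 / Suc k \<and> (1 / Suc n) * dist x y < infdist y S}" for n :: nat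
  have "negligible (P n)" for n
  proof -
    have op: "open {x. \<exists>y. dist x y < 1 / Suc k \<and> (1 / Suc n) * dist x y < infdist y S}" for k :: nat
      by (intro open_Collect_ex open_Collect_conj open_Collect_less continuous_intros)
    have "P n = S \<inter> (\<Inter>k. {x. \<exists>y. dist x y < 1 / Suc k \<and> (1 / Suc n) * dist x y < infdist y S})"
      by (auto simp: P_def)
    also have "\<dots> \<in> sets borel"
      using S op by (intro sets.Int sets.countable_INT'' borel_closed borel_open) auto
    finally have Pb: "P n \<in> sets borel" .
    then have PL: "P n \<in> sets lebesgue" by auto
    define \<sigma> where "\<sigma> = 1 / real (Suc n)"
    have \<sigma>: "0 < \<sigma>" "\<sigma> \<le> 1" by (auto simp: \<sigma>_def field_simps)
    define \<theta> where "\<theta> = 1 - (\<sigma> / 2) ^ DIM('a)"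
    have \<theta>: "0 \<le> \<theta>" "\<theta> < 1" using \<sigma> by (auto simp: \<theta>_def power_le_one)
    show ?thesis
    proof (rule negligible_density_less_one[OF PL \<theta>])
      fix x d assume x: "x \<in> P n" and d: "(0::real) < d"
      obtain k where k: "1 / Suc k < d / 2" using nat_approx_posE[of "d/2"] d by auto
      obtain y where y: "dist x y < 1 / Suc k" "\<sigma> * dist x y < infdist y S"
        using x by (auto simp: P_def \<sigma>_def)
      define \<rho> where "\<rho> = dist x y"
      have xS: "x \<in> S" using x by (auto simp: P_def)
      have \<rho>: "\<rho> > 0" using y(2) xS by (cases "x = y") (auto simp: \<rho>_def)
      have \<rho>0: "2 * \<rho> \<ge> 0" "\<sigma> * \<rho> \<ge> 0" using \<rho> \<sigma> by auto
      have \<rho>d: "2 * \<rho> < d" using y k by (simp add: \<rho>_def)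
      have sub: "ball y (\<sigma> * \<rho>) \<subseteq> ball x (2 * \<rho>)"
      proof
        fix z assume "z \<in> ball y (\<sigma> * \<rho>)"
        moreover have "\<sigma> * \<rho> \<le> \<rho>" using \<sigma> \<rho> by (simp add: mult_left_le_one_le)
        ultimately show "z \<in> ball x (2 * \<rho>)" using dist_triangle[of x z y] by (auto simp: \<rho>_def)
      qed
      have dis: "P n \<inter> ball y (\<sigma> * \<rho>) = {}"
      proof -
        have False if "z \<in> S" "dist y z < \<sigma> * \<rho>" for z
          using infdist_le[OF that(1), of y] that(2) y(2) by (simp add: \<rho>_def)
        then show ?thesis by (auto simp: P_def)
      qed
      have "emeasure lebesgue (P n \<inter> ball x (2 * \<rho>)) \<le> emeasure lebesgue (ball x (2 * \<rho>) - ball y (\<sigma> * \<rho>))"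
        using dis by (intro emeasure_mono) auto
      also have "\<dots> = ennreal (measure lebesgue (ball x (2 * \<rho>) - ball y (\<sigma> * \<rho>)))"
        by (intro emeasure_eq_measure2 fmeasurable.Diff) auto
      also have "measure lebesgue (ball x (2 * \<rho>) - ball y (\<sigma> * \<rho>)) = measure lborel (ball x (2 * \<rho>)) - measure lborel (ball y (\<sigma> * \<rho>))"
        using sub by (subst measurable_measure_Diff) auto
      also have "\<dots> = \<theta> * measure lborel (ball x (2 * \<rho>))"
        using \<sigma> \<rho> unfolding content_ball_conv_unit_ball[OF \<rho>0(1), of x] content_ball_conv_unit_ball[OF \<rho>0(2), of y]
        by (simp add: \<theta>_def algebra_simps power_mult_distrib power_divide)
      also have "ennreal \<dots> = ennreal \<theta> * ennreal (measure lborel (ball x (2 * \<rho>)))"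
        using \<theta> by (simp add: ennreal_mult')
      also have "ennreal (measure lborel (ball x (2 * \<rho>))) = emeasure lebesgue (ball x (2 * \<rho>))"
        using emeasure_eq_measure2[of "ball x (2 * \<rho>)" lebesgue] by simp
      finally show "\<exists>a r. 0 < r \<and> r < d \<and> x \<in> ball a r \<and>
          emeasure lebesgue (P n \<inter> ball a r) \<le> ennreal \<theta> * emeasure lebesgue (ball a r)"
        using \<rho> \<rho>d by (intro exI[of _ x] exI[of _ "2 * \<rho>"]) auto
    qed
  qed
  then have "negligible (\<Union>n. P n)" by (intro negligible_countable_Union) auto
  moreover have "{x\<in>S. \<exists>\<sigma>>0. \<forall>d>0. \<exists>y. dist x y < d \<and> \<sigma> * dist x y < infdist y S} \<subseteq> (\<Union>n. P n)"
  proof clarify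
    fix x \<sigma> assume x: "x \<in> S" "(0::real) < \<sigma>" "\<forall>d>0. \<exists>y. dist x y < d \<and> \<sigma> * dist x y < infdist y S"
    obtain n where n: "1 / Suc n < \<sigma>" using nat_approx_posE[OF x(2)] by blast
    have "x \<in> P n"
      unfolding P_def
    proof (intro CollectI conjI x allI)
      fix k :: nat
      obtain y where y: "dist x y < 1 / Suc k" "\<sigma> * dist x y < infdist y S"
        using x(3)[rule_format, of "1 / Suc k"] by auto
      have "1 / Suc n * dist x y \<le> \<sigma> * dist x y" using n by (intro mult_right_mono) auto
      then show "\<exists>y. dist x y < 1 / Suc k \<and> 1 / Suc n * dist x y < infdist y S" using y by (intro exI[of _ y]) linarith
    qed
    then show "x \<in> (\<Union>n. P n)" by blast
  qed
  ultimately show ?thesis by (rule negligible_subset)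
qed

lemma approx_differentiable_at_density_point:
  fixes \<phi> :: "'a::euclidean_space \<Rightarrow> real" and \<tau> \<sigma> L r :: real
  assumes L0: "0 \<le> L" and L: "\<And>x y. \<bar>\<phi> x - \<phi> y\<bar> \<le> L * norm (x - y)"
    and S: "closed S" "x \<in> S" and \<sigma>: "0 \<le> \<sigma>" and rpos: "r > 0" and \<tau>: "0 \<le> \<tau>"
    and dens: "\<And>y. dist x y < r \<Longrightarrow> infdist y S \<le> \<sigma> * dist x y"
    and part: "\<And>s i t. s \<in> S \<Longrightarrow> i \<in> Basis \<Longrightarrow> \<bar>t\<bar> < r \<Longrightarrow> \<bar>\<phi> (s + t *\<^sub>R i) - \<phi> s - a i * t\<bar> \<le> \<tau> * \<bar>t\<bar>"
    and h: "DIM('a) * norm h < r"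
  shows "\<bar>\<phi> (x + h) - \<phi> x - (\<Sum>i\<in>Basis. a i *\<^sub>R i) \<bullet> h\<bar> \<le> DIM('a) * (\<tau> + 2 * L * \<sigma> * DIM('a)) * norm h"
proof -
  define hs where "hs J = (\<Sum>i\<in>J. (h \<bullet> i) *\<^sub>R i)" for J :: "'a set"
  have hi: "\<bar>h \<bullet> i\<bar> \<le> norm h" if "i \<in> Basis" for i using Basis_le_norm[OF that] .
  have D1: "real DIM('a) \<ge> 1" by (simp add: Suc_leI)
  have hd: "norm h < r" using h D1 mult_right_mono[OF D1, of "norm h"] by simp
  have claim: "\<bar>\<phi> (x + hs J) - \<phi> x - (\<Sum>i\<in>J. a i * (h \<bullet> i))\<bar> \<le> card J * ((\<tau> + 2 * L * \<sigma> * DIM('a)) * norm h)"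
    if "finite J" "J \<subseteq> Basis" for J using that
  proof (induction J)
    case empty
    then show ?case by (simp add: hs_def)
  next
    case (insert j J)
    have j: "j \<in> Basis" and J: "J \<subseteq> Basis" using insert by auto
    have "norm (hs J) \<le> (\<Sum>i\<in>J. norm h)" unfolding hs_def
      using J hi by (intro sum_norm_le) auto
    also have "\<dots> \<le> DIM('a) * norm h" using card_mono[OF finite_Basis J] by (simp add: mult_right_mono)
    finally have nh: "norm (hs J) \<le> DIM('a) * norm h" .
    define y where "y = x + hs J"
    have "dist x y < r" using nh h by (simp add: y_def dist_norm)
    then have "infdist y S \<le> \<sigma> * dist x y" by (rule dens)
    also have "\<dots> \<le> \<sigma> * (DIM('a) * norm h)" using nh \<sigma> by (intro mult_left_mono) (auto simp: y_def dist_norm)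
    finally have inf: "infdist y S \<le> \<sigma> * (DIM('a) * norm h)" .
    obtain s where s: "s \<in> S" "dist y s \<le> \<sigma> * (DIM('a) * norm h)"
      using infdist_attains_inf[of S y] S inf by (metis empty_iff)
    have e1: "\<bar>\<phi> (s + (h \<bullet> j) *\<^sub>R j) - \<phi> s - a j * (h \<bullet> j)\<bar> \<le> \<tau> * norm h"
      using part[OF s(1) j, of "h \<bullet> j"] hi[OF j] hd mult_left_mono[OF hi[OF j] \<tau>] by linarith
    have e2: "\<bar>\<phi> y - \<phi> s\<bar> \<le> L * (\<sigma> * (DIM('a) * norm h))"
      using L[of y s] mult_left_mono[OF s(2) L0] by (simp add: dist_norm)
    have e3: "\<bar>\<phi> (y + (h \<bullet> j) *\<^sub>R j) - \<phi> (s + (h \<bullet> j) *\<^sub>R j)\<bar> \<le> L * (\<sigma> * (DIM('a) * norm h))"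
      using L[of "y + (h \<bullet> j) *\<^sub>R j" "s + (h \<bullet> j) *\<^sub>R j"] mult_left_mono[OF s(2) L0] by (simp add: dist_norm)
    have eq: "x + hs (insert j J) = y + (h \<bullet> j) *\<^sub>R j" using insert by (simp add: hs_def y_def)
    have IH: "\<bar>\<phi> y - \<phi> x - (\<Sum>i\<in>J. a i * (h \<bullet> i))\<bar> \<le> card J * ((\<tau> + 2 * L * \<sigma> * DIM('a)) * norm h)"
      using insert J by (simp add: y_def)
    have step: "(\<tau> + 2 * L * \<sigma> * DIM('a)) * norm h = \<tau> * norm h + 2 * (L * (\<sigma> * (DIM('a) * norm h)))"
      by (simp add: algebra_simps)
    have "\<bar>\<phi> (y + (h \<bullet> j) *\<^sub>R j) - \<phi> x - (a j * (h \<bullet> j) + (\<Sum>i\<in>J. a i * (h \<bullet> i)))\<bar>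
      \<le> card J * ((\<tau> + 2 * L * \<sigma> * DIM('a)) * norm h) + (\<tau> + 2 * L * \<sigma> * DIM('a)) * norm h"
      using e1 e2 e3 IH unfolding step by linarith
    then show ?case using insert(1,2) unfolding eq by (simp add: algebra_simps)
  qed
  have "hs Basis = h" by (simp add: hs_def euclidean_representation)
  moreover have "(\<Sum>i\<in>Basis. a i *\<^sub>R i) \<bullet> h = (\<Sum>i\<in>Basis. a i * (h \<bullet> i))"
    by (simp add: inner_sum_left) (simp add: inner_commute)
  ultimately show ?thesis using claim[of Basis] by (simp add: mult.assoc)
qed

lemma lipschitz_approx_differentiable_ae:
  fixes \<phi> :: "'a::euclidean_space \<Rightarrow> real"
  assumes L0: "0 \<le> L" and L: "\<And>x y. \<bar>\<phi> x - \<phi> y\<bar> \<le> L * norm (x - y)" and \<tau>: "\<tau> > 0"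
  shows "negligible {x. \<not> (\<exists>a. \<exists>d>0. \<forall>h. norm h < d \<longrightarrow> \<bar>\<phi> (x + h) - \<phi> x - a \<bullet> h\<bar> \<le> \<tau> * norm h)}"
proof -
  define D where "D = real DIM('a)"
  have D: "D \<ge> 1" by (simp add: Suc_leI D_def)
  define \<tau>0 where "\<tau>0 = \<tau> / (2 * D)"
  define \<sigma> where "\<sigma> = \<tau> / (4 * (L + 1) * D * D)"
  have pos: "\<tau>0 > 0" "\<sigma> > 0" using D \<tau> L0 by (auto simp: \<tau>0_def \<sigma>_def)
  have bound: "D * (\<tau>0 + 2 * L * \<sigma> * D) \<le> \<tau>"
  proof -
    have "D * (\<tau>0 + 2 * L * \<sigma> * D) = \<tau> / 2 + (L / (L + 1)) * (\<tau> / 2)"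
      using D L0 by (simp add: \<tau>0_def \<sigma>_def divide_simps) (simp add: algebra_simps)
    also have "(L / (L + 1)) * (\<tau> / 2) \<le> 1 * (\<tau> / 2)" using L0 \<tau> by (intro mult_right_mono) auto
    finally show ?thesis by simp
  qed
  have cont: "continuous_on UNIV \<phi>"
    using L L0 by (intro lipschitz_on_continuous_on[of L]) (auto simp: dist_real_def dist_norm lipschitz_on_def)
  define S where "S a k = {x. \<forall>i\<in>Basis. \<forall>t. \<bar>t\<bar> < 1 / Suc k \<longrightarrow> \<bar>\<phi> (x + t *\<^sub>R i) - \<phi> x - a i * t\<bar> \<le> \<tau>0 * \<bar>t\<bar>}"
    for a :: "'a \<Rightarrow> real" and k :: nat
  have cl: "closed (S a k)" for a k unfolding S_def Ball_def
    by (intro closed_Collect_all closed_Collect_imp open_Collect_const closed_Collect_le continuous_intros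
      continuous_on_compose2[OF cont]) auto
  define bad where "bad i = {x. \<not> (\<exists>a\<in>\<rat>. \<exists>k::nat. \<forall>t. \<bar>t\<bar> < 1 / Suc k \<longrightarrow>
    \<bar>\<phi> (x + t *\<^sub>R i) - \<phi> x - a * t\<bar> \<le> \<tau>0 * \<bar>t\<bar>)}" for i
  define por where "por T = {x\<in>T. \<exists>\<sigma>>0. \<forall>d>0. \<exists>y. dist x y < d \<and> \<sigma> * dist x y < infdist y T}" for T :: "'a set"
  define I where "I = (Basis \<rightarrow>\<^sub>E \<rat> :: ('a \<Rightarrow> real) set) \<times> (UNIV :: nat set)"
  have "countable I" unfolding I_def using countable_rat
    by (intro countable_SIGMA countable_PiE) auto
  then have "negligible (\<Union>(a, k)\<in>I. por (S a k))"
    by (intro negligible_countable_Union) (auto simp: por_def intro: closed_porous_points_negligible cl)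
  moreover have "negligible (\<Union>i\<in>Basis. bad i)"
    using lipschitz_approx_directional_derivative_ae[OF L0 L pos(1)]
    by (intro negligible_Union) (auto simp: bad_def)
  ultimately have neg: "negligible ((\<Union>(a, k)\<in>I. por (S a k)) \<union> (\<Union>i\<in>Basis. bad i))" by (rule negligible_Un)
  show ?thesis
  proof (rule negligible_subset[OF neg], rule subsetI, rule ccontr)
    fix x assume x: "x \<in> {x. \<not> (\<exists>a. \<exists>d>0. \<forall>h. norm h < d \<longrightarrow> \<bar>\<phi> (x + h) - \<phi> x - a \<bullet> h\<bar> \<le> \<tau> * norm h)}"
      and nx: "x \<notin> (\<Union>(a, k)\<in>I. por (S a k)) \<union> (\<Union>i\<in>Basis. bad i)"
    then have "\<forall>i\<in>Basis. \<exists>a k. a \<in> \<rat> \<and> (\<forall>t. \<bar>t\<bar> < 1 / real (Suc k) \<longrightarrow> \<bar>\<phi> (x + t *\<^sub>R i) - \<phi> x - a * t\<bar> \<le> \<tau>0 * \<bar>t\<bar>)"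
      unfolding bad_def by blast
    then obtain a0 k0 where ak: "\<And>i. i \<in> Basis \<Longrightarrow> a0 i \<in> \<rat>"
      "\<And>i t. i \<in> Basis \<Longrightarrow> \<bar>t\<bar> < 1 / real (Suc (k0 i)) \<Longrightarrow> \<bar>\<phi> (x + t *\<^sub>R i) - \<phi> x - a0 i * t\<bar> \<le> \<tau>0 * \<bar>t\<bar>"
      by metis
    define a where "a = restrict a0 Basis"
    define k where "k = Max (k0 ` Basis)"
    have aI: "(a, k) \<in> I" using ak by (auto simp: I_def a_def)
    have xS: "x \<in> S a k" unfolding S_def
    proof (intro CollectI ballI allI impI)
      fix i :: 'a and t assume i: "i \<in> Basis" and t: "\<bar>t\<bar> < 1 / real (Suc k)"
      have "k0 i \<le> k" using i by (simp add: k_def)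
      then have "1 / real (Suc k) \<le> 1 / real (Suc (k0 i))" by (simp add: field_simps)
      then show "\<bar>\<phi> (x + t *\<^sub>R i) - \<phi> x - a i * t\<bar> \<le> \<tau>0 * \<bar>t\<bar>" using ak(2)[OF i, of t] t i by (simp add: a_def)
    qed
    have "x \<notin> por (S a k)" using nx aI by auto
    then have "\<exists>d>0. \<forall>y. dist x y < d \<longrightarrow> infdist y (S a k) \<le> \<sigma> * dist x y"
      unfolding por_def using xS pos(2) by (simp add: not_less) (meson not_less)
    then obtain d where d: "d > 0" "\<And>y. dist x y < d \<Longrightarrow> infdist y (S a k) \<le> \<sigma> * dist x y"
      by blast
    define d0 where "d0 = min d (1 / Suc k)"
    have "\<bar>\<phi> (x + h) - \<phi> x - (\<Sum>i\<in>Basis. a i *\<^sub>R i) \<bullet> h\<bar> \<le> \<tau> * norm h" if "norm h < d0 / D" for h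
    proof -
      have "\<bar>\<phi> (x + h) - \<phi> x - (\<Sum>i\<in>Basis. a i *\<^sub>R i) \<bullet> h\<bar> \<le> DIM('a) * (\<tau>0 + 2 * L * \<sigma> * DIM('a)) * norm h"
        using that D d pos
        by (intro approx_differentiable_at_density_point[OF L0 L cl xS, where r = d0])
           (auto simp: d0_def S_def D_def[symmetric] field_simps simp del: of_nat_Suc)
      also have "\<dots> \<le> \<tau> * norm h" using bound by (intro mult_right_mono) (auto simp: D_def)
      finally show ?thesis .
    qed
    moreover have "d0 / D > 0" using D d by (simp add: d0_def)
    ultimately show False using x by blast
  qed
qed

lemma gradient_lipschitz_of_paraboloids:
  fixes f :: "'a::real_inner \<Rightarrow> real"
  assumes C: "0 \<le> C" and fg: "\<And>x h. \<bar>f (x + h) - f x - g x \<bullet> h\<bar> \<le> C * (norm h)\<^sup>2"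
  shows "norm (g x - g y) \<le> 6 * C * norm (x - y)"
proof (cases "g x = g y \<or> x = y")
  case True
  then show ?thesis using C by auto
next
  case False
  define t where "t = norm (x - y)"
  have t: "t > 0" using False by (simp add: t_def)
  define h where "h = (t / norm (g x - g y)) *\<^sub>R (g x - g y)"
  have nh: "norm h = t" using t False by (simp add: h_def)
  have dh: "(g x - g y) \<bullet> h = t * norm (g x - g y)"
    using False by (simp add: h_def power2_norm_eq_inner[symmetric] power2_eq_square)
  have nyh: "(norm (y + h - x))\<^sup>2 \<le> (2 * t)\<^sup>2"
  proof (rule power_mono)
    show "norm (y + h - x) \<le> 2 * t" using norm_triangle_ineq[of h "y - x"] nh
      by (simp add: t_def norm_minus_commute algebra_simps)
  qed simp
  have 1: "f (y + h) \<ge> f x + g x \<bullet> (y + h - x) - C * (norm (y + h - x))\<^sup>2"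
    using fg[of x "y + h - x"] by simp
  have 2: "f (y + h) \<le> f y + g y \<bullet> h + C * t\<^sup>2" using fg[of y h] nh by simp
  have 3: "f y \<le> f x + g x \<bullet> (y - x) + C * t\<^sup>2"
    using fg[of x "y - x"] by (simp add: t_def norm_minus_commute)
  have "(g x - g y) \<bullet> h \<le> C * (norm (y + h - x))\<^sup>2 + 2 * C * t\<^sup>2"
    using 1 2 3 by (simp add: inner_diff_right inner_add_right inner_diff_left)
  also have "\<dots> \<le> C * (2 * t)\<^sup>2 + 2 * C * t\<^sup>2" using mult_left_mono[OF nyh C] by simp
  finally have "t * norm (g x - g y) \<le> t * (6 * C * t)" unfolding dh by (simp add: power2_eq_square algebra_simps)
  then show ?thesis using t by (simp add: t_def)
qed

lemma has_derivative_of_paraboloids: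
  fixes f :: "'a::real_inner \<Rightarrow> real"
  assumes fg: "\<And>h. \<bar>f (x + h) - f x - p \<bullet> h\<bar> \<le> C * (norm h)\<^sup>2"
  shows "(f has_derivative (\<lambda>h. p \<bullet> h)) (at x)"
proof (rule has_derivativeI_sandwich[of 1])
  show "bounded_linear ((\<bullet>) p)" by (rule bounded_linear_inner_right)
  show "norm (f y - f x - p \<bullet> (y - x)) / norm (y - x) \<le> C * norm (y - x)" if "y \<noteq> x" for y
    using fg[of "y - x"] that by (simp add: field_simps power2_eq_square)
  show "((\<lambda>y. C * norm (y - x)) \<longlongrightarrow> 0) (at x)"
    by (rule tendsto_eq_intros refl | simp)+
qed simp

text \<open>Weak form of Alexandrov's theorem. Replacing the approximate derivative of the gradient by its symmetric part does not change the
  quadratic form.\<close>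

lemma approx_second_order_ae:
  fixes f :: "real^'n \<Rightarrow> real"
  assumes C: "0 \<le> C" and fg: "\<And>x h. \<bar>f (x + h) - f x - g x \<bullet> h\<bar> \<le> C * (norm h)\<^sup>2" and \<tau>: "\<tau> > 0"
  shows "negligible {x. \<not> (\<exists>A d. transpose A = A \<and> d > 0 \<and> (\<forall>h. norm h < d \<longrightarrow>
    \<bar>f (x + h) - f x - g x \<bullet> h - (h \<bullet> (A *v h)) / 2\<bar> \<le> \<tau> * (norm h)\<^sup>2))}"
proof -
  define N where "N = real CARD('n)"
  have N: "N > 0" by (simp add: N_def)
  have glip: "\<bar>g x $ i - g y $ i\<bar> \<le> 6 * C * norm (x - y)" for x y i
    using component_le_norm_cart[of "g x - g y" i] gradient_lipschitz_of_paraboloids[OF C fg, of x y] by simp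
  define bad where "bad i = {x. \<not> (\<exists>a. \<exists>d>0. \<forall>h. norm h < d \<longrightarrow> \<bar>g (x + h) $ i - g x $ i - a \<bullet> h\<bar> \<le> \<tau> / N * norm h)}" for i
  have "negligible (bad i)" for i
    unfolding bad_def using C \<tau> N by (intro lipschitz_approx_differentiable_ae[OF _ glip]) auto
  then have neg: "negligible (\<Union>i. bad i)" by (intro negligible_Union) auto
  show ?thesis
  proof (rule negligible_subset[OF neg], rule subsetI, rule ccontr)
    fix x assume x: "x \<in> {x. \<not> (\<exists>A d. transpose A = A \<and> d > 0 \<and> (\<forall>h. norm h < d \<longrightarrow>
      \<bar>f (x + h) - f x - g x \<bullet> h - (h \<bullet> (A *v h)) / 2\<bar> \<le> \<tau> * (norm h)\<^sup>2))}" and nx: "x \<notin> (\<Union>i. bad i)"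
    then have "\<forall>i. \<exists>a d. d > 0 \<and> (\<forall>h. norm h < d \<longrightarrow> \<bar>g (x + h) $ i - g x $ i - a \<bullet> h\<bar> \<le> \<tau> / N * norm h)"
      unfolding bad_def by blast
    then obtain a d0 where ad: "\<And>i. d0 i > 0"
      "\<And>i h. norm h < d0 i \<Longrightarrow> \<bar>g (x + h) $ i - g x $ i - a i \<bullet> h\<bar> \<le> \<tau> / N * norm h" by metis
    define d where "d = Min (range d0)"
    have d: "d > 0" "\<And>i. d \<le> d0 i" using ad(1) by (auto simp: d_def)
    define M where "M = (\<chi> i. a i)"
    have gM: "norm (g (x + h) - g x - M *v h) \<le> \<tau> * norm h" if "norm h < d" for h
    proof -
      have "norm (g (x + h) - g x - M *v h) \<le> (\<Sum>i\<in>UNIV. \<bar>(g (x + h) - g x - M *v h) $ i\<bar>)"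
        by (rule norm_le_l1_cart)
      also have "\<dots> \<le> (\<Sum>i\<in>(UNIV::'n set). \<tau> / N * norm h)"
      proof (rule sum_mono)
        fix i
        have "norm h < d0 i" using that d(2)[of i] by simp
        from ad(2)[OF this] show "\<bar>(g (x + h) - g x - M *v h) $ i\<bar> \<le> \<tau> / N * norm h"
          by (simp add: M_def matrix_vector_mul_component)
      qed
      also have "\<dots> = \<tau> * norm h" using N by (simp add: N_def)
      finally show ?thesis .
    qed
    define A where "A = (1/2) *\<^sub>R (M + transpose M)"
    have tA: "transpose A = A" by (simp add: A_def transpose_def vec_eq_iff add.commute)
    have hA: "h \<bullet> (A *v h) = h \<bullet> (M *v h)" for h
    proof -
      have "h \<bullet> (transpose M *v h) = h \<bullet> (M *v h)"
        by (metis dot_lmul_matrix inner_commute transpose_matrix_vector)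
      then show ?thesis by (simp add: A_def scaleR_matrix_vector_assoc[symmetric] matrix_vector_mult_add_rdistrib inner_add_right)
    qed
    have "\<bar>f (x + h) - f x - g x \<bullet> h - (h \<bullet> (A *v h)) / 2\<bar> \<le> \<tau> * (norm h)\<^sup>2" if h: "norm h < d" for h
    proof -
      define F where "F s = f (x + s *\<^sub>R h) - s * (g x \<bullet> h) - s\<^sup>2 / 2 * (h \<bullet> (M *v h))" for s
      have der: "(F has_real_derivative (g (x + s *\<^sub>R h) \<bullet> h - g x \<bullet> h - s * (h \<bullet> (M *v h)))) (at s)" for s
      proof -
        have 1: "((\<lambda>s. f (x + s *\<^sub>R h)) has_derivative (\<lambda>t. g (x + s *\<^sub>R h) \<bullet> (t *\<^sub>R h))) (at s)"
        proof (rule has_derivative_compose[where f = "\<lambda>s. x + s *\<^sub>R h"])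
          show "((\<lambda>s. x + s *\<^sub>R h) has_derivative (\<lambda>t. t *\<^sub>R h)) (at s)" by (auto intro!: derivative_eq_intros)
          show "(f has_derivative (\<lambda>k. g (x + s *\<^sub>R h) \<bullet> k)) (at (x + s *\<^sub>R h))"
            by (rule has_derivative_of_paraboloids[OF fg])
        qed
        have d1: "((\<lambda>s. f (x + s *\<^sub>R h)) has_real_derivative (g (x + s *\<^sub>R h) \<bullet> h)) (at s)"
          unfolding has_field_derivative_def
          by (rule has_derivative_eq_rhs[OF 1]) (auto simp: mult.commute)
        show ?thesis unfolding F_def
          by (auto intro!: derivative_eq_intros d1)
      qed
      obtain s where s: "0 < s" "s < 1" "F 1 - F 0 = (1 - 0) * (g (x + s *\<^sub>R h) \<bullet> h - g x \<bullet> h - s * (h \<bullet> (M *v h)))"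
        using MVT2[of 0 1 F] der by force
      have nsh: "norm (s *\<^sub>R h) \<le> norm h" using s by (simp add: mult_left_le_one_le)
      have "F 1 - F 0 = (g (x + s *\<^sub>R h) - g x - M *v (s *\<^sub>R h)) \<bullet> h"
        using s(3) by (simp add: inner_diff_left inner_diff_right matrix_vector_mult_scaleR inner_commute)
      then have "\<bar>F 1 - F 0\<bar> \<le> norm (g (x + s *\<^sub>R h) - g x - M *v (s *\<^sub>R h)) * norm h"
        using Cauchy_Schwarz_ineq2 by metis
      also have "\<dots> \<le> (\<tau> * norm (s *\<^sub>R h)) * norm h" using gM[of "s *\<^sub>R h"] nsh h by (intro mult_right_mono) auto
      also have "\<dots> \<le> (\<tau> * norm h) * norm h" using nsh \<tau> by (intro mult_right_mono mult_left_mono) auto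
      finally show ?thesis unfolding F_def hA by (simp add: power2_eq_square)
    qed
    then show False using x tA d(1) by blast
  qed
qed

section \<open>Sup-convolutions and Lasry--Lions regularization\<close>

lemma usc_on_attains_sup:
  assumes K: "compact K" "K \<noteq> {}" and u: "usc_on K u"
  shows "\<exists>x\<in>K. \<forall>y\<in>K. u y \<le> u x"
proof (rule ccontr)
  assume "\<not> ?thesis"
  then have "K \<subseteq> \<Union>((\<lambda>x. {y\<in>K. u y < u x}) ` K)" by (auto simp: not_le)
  moreover have "\<forall>c\<in>(\<lambda>x. {y\<in>K. u y < u x}) ` K. openin (top_of_set K) c" using u by (auto simp: usc_on_def)
  ultimately obtain D where D: "D \<subseteq> (\<lambda>x. {y\<in>K. u y < u x}) ` K" "finite D" "K \<subseteq> \<Union>D"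
    using K(1) unfolding compact_eq_openin_cover by meson
  obtain X where X: "X \<subseteq> K" "finite X" "D = (\<lambda>x. {y\<in>K. u y < u x}) ` X"
    using finite_subset_image[OF D(2,1)] by blast
  then have "X \<noteq> {}" using D K by auto
  then obtain x where x: "x \<in> X" "u x = Max (u ` X)" using X(2) Max_in[of "u ` X"] by fastforce
  then obtain x' where x': "x' \<in> X" "u x < u x'" using D(3) X by blast
  have "u x' \<le> Max (u ` X)" using x'(1) X(2) by (intro Max_ge) auto
  then show False using x x' by simp
qed

lemma usc_on_add_continuous:
  assumes u: "usc_on S u" and g: "continuous_on S g"
  shows "usc_on S (\<lambda>x. u x + g x)"
  unfolding usc_on_def
proof
  fix t
  have "{x\<in>S. u x + g x < t} = (\<Union>r. {x\<in>S. u x < r} \<inter> (S \<inter> g -` {..<t - r}))"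
  proof (intro set_eqI iffI)
    fix x assume x: "x \<in> {x\<in>S. u x + g x < t}"
    then have "u x < t - g x" by auto
    then obtain r where "u x < r" "r < t - g x" using dense by blast
    then show "x \<in> (\<Union>r. {x\<in>S. u x < r} \<inter> (S \<inter> g -` {..<t - r}))" using x by (auto intro!: exI[of _ r])
  qed auto
  also have "openin (top_of_set S) \<dots>"
    using u g by (intro openin_Union ballI)
      (auto simp: usc_on_def intro!: openin_Int continuous_openin_preimage_gen)
  finally show "openin (top_of_set S) {x\<in>S. u x + g x < t}" .
qed

lemma continuous_on_imp_usc_on:
  assumes "continuous_on S g"
  shows "usc_on S g"
proof -
  have "usc_on S (\<lambda>x. 0)" unfolding usc_on_def by (intro allI, case_tac "0 < t") auto
  from usc_on_add_continuous[OF this assms] show ?thesis by simp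
qed

definition supconv :: "real \<Rightarrow> (real^'n) set \<Rightarrow> (real^'n \<Rightarrow> real) \<Rightarrow> real^'n \<Rightarrow> real" where
  "supconv k K u x = (SUP y\<in>K. u y - k * (norm (x - y))\<^sup>2)"

lemma supconv_attained_ge:
  assumes "compact K" "K \<noteq> {}" "usc_on K u"
  shows supconv_attained: "\<exists>y\<in>K. supconv k K u x = u y - k * (norm (x - y))\<^sup>2"
    and supconv_ge: "y \<in> K \<Longrightarrow> u y - k * (norm (x - y))\<^sup>2 \<le> supconv k K u x"
proof -
  have "usc_on K (\<lambda>y. u y + - (k * (norm (x - y))\<^sup>2))"
    using assms by (intro usc_on_add_continuous continuous_intros) auto
  then obtain z where z: "z \<in> K" "\<And>y. y \<in> K \<Longrightarrow> u y - k * (norm (x - y))\<^sup>2 \<le> u z - k * (norm (x - z))\<^sup>2"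
    using usc_on_attains_sup[OF assms(1,2)] by (metis (no_types, lifting) uminus_add_conv_diff add.commute)
  have "supconv k K u x = u z - k * (norm (x - z))\<^sup>2"
    unfolding supconv_def using z by (intro cSup_eq_maximum) auto
  then show "\<exists>y\<in>K. supconv k K u x = u y - k * (norm (x - y))\<^sup>2"
    "y \<in> K \<Longrightarrow> u y - k * (norm (x - y))\<^sup>2 \<le> supconv k K u x" using z by auto
qed

lemma norm_add_squared: "(norm (a + b))\<^sup>2 = (norm a)\<^sup>2 + 2 * (a \<bullet> b) + (norm b)\<^sup>2" for a b :: "'a::real_inner"
  by (simp add: power2_norm_eq_inner inner_add_left inner_add_right inner_commute)

lemma supconv_lower_paraboloid:
  assumes "compact K" "K \<noteq> {}" "usc_on K u"
  shows "\<exists>s. \<forall>h. supconv k K u (x + h) \<ge> supconv k K u x + s \<bullet> h - k * (norm h)\<^sup>2"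
proof -
  obtain y where y: "y \<in> K" "supconv k K u x = u y - k * (norm (x - y))\<^sup>2" using supconv_attained[OF assms] by blast
  have "supconv k K u (x + h) \<ge> supconv k K u x + (- (2 * k) *\<^sub>R (x - y)) \<bullet> h - k * (norm h)\<^sup>2" for h
  proof -
    have "x + h - y = (x - y) + h" by simp
    then have "(norm (x + h - y))\<^sup>2 = (norm (x - y))\<^sup>2 + 2 * ((x - y) \<bullet> h) + (norm h)\<^sup>2"
      by (simp only: norm_add_squared)
    then have "k * (norm (x + h - y))\<^sup>2 = k * (norm (x - y))\<^sup>2 + (2 * k) * ((x - y) \<bullet> h) + k * (norm h)\<^sup>2"
      by (simp add: distrib_left)
    then show ?thesis using supconv_ge[OF assms y(1), of k "x + h"] y(2) by simp
  qed
  then show ?thesis by blast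
qed

lemma supconv_midpoint:
  assumes "compact K" "K \<noteq> {}" "usc_on K u"
  shows "supconv k K u (x + h) + supconv k K u (x - h) \<ge> 2 * supconv k K u x - 2 * k * (norm h)\<^sup>2"
proof -
  obtain s where s: "\<And>h. supconv k K u (x + h) \<ge> supconv k K u x + s \<bullet> h - k * (norm h)\<^sup>2"
    using supconv_lower_paraboloid[OF assms] by blast
  show ?thesis using s[of h] s[of "- h"] by simp
qed

lemma supconv_continuous:
  assumes K: "compact K" "K \<noteq> {}" "usc_on K u" and k: "0 \<le> k"
  shows "continuous_on (cball 0 r) (supconv k K u)"
proof -
  obtain \<rho> where \<rho>: "\<And>y. y \<in> K \<Longrightarrow> norm y \<le> \<rho>" using compact_imp_bounded[OF K(1)] bounded_iff by blast
  have \<rho>0: "0 \<le> \<rho>" using \<rho> K(2) norm_ge_zero order_trans by (metis all_not_in_conv)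
  define C where "C = k * (2 * \<bar>r\<bar> + 2 * \<rho>)"
  have le: "supconv k K u x - supconv k K u x' \<le> C * norm (x - x')" if "x \<in> cball 0 r" "x' \<in> cball 0 r" for x x'
  proof -
    obtain y where y: "y \<in> K" "supconv k K u x = u y - k * (norm (x - y))\<^sup>2" using supconv_attained[OF K] by blast
    have "(norm (x' - y))\<^sup>2 - (norm (x - y))\<^sup>2 = (x' - x) \<bullet> (x' + x - 2 *\<^sub>R y)"
      by (simp add: power2_norm_eq_inner inner_diff_left inner_diff_right inner_add_right inner_commute)
    also have "\<dots> \<le> norm (x' - x) * norm (x' + x - 2 *\<^sub>R y)" by (rule norm_cauchy_schwarz)
    also have "\<dots> \<le> norm (x' - x) * (2 * \<bar>r\<bar> + 2 * \<rho>)"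
    proof (rule mult_left_mono)
      show "norm (x' + x - 2 *\<^sub>R y) \<le> 2 * \<bar>r\<bar> + 2 * \<rho>"
        using norm_triangle_ineq4[of "x' + x" "2 *\<^sub>R y"] norm_triangle_ineq[of x' x] \<rho>[OF y(1)] that by simp
    qed simp
    finally have "k * ((norm (x' - y))\<^sup>2 - (norm (x - y))\<^sup>2) \<le> k * (norm (x' - x) * (2 * \<bar>r\<bar> + 2 * \<rho>))"
      using k by (rule mult_left_mono)
    then show ?thesis using supconv_ge[OF K y(1), of k x'] y(2)
      by (simp add: C_def algebra_simps norm_minus_commute)
  qed
  have "C-lipschitz_on (cball 0 r) (supconv k K u)"
  proof (rule lipschitz_onI)
    show "dist (supconv k K u x) (supconv k K u y) \<le> C * dist x y" if "x \<in> cball 0 r" "y \<in> cball 0 r" for x y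
      using le[OF that] le[OF that(2,1)] by (simp add: dist_norm abs_le_iff norm_minus_commute)
  qed (use k \<rho>0 in \<open>auto simp: C_def\<close>)
  then show ?thesis by (rule lipschitz_on_continuous_on)
qed

text \<open>The Lasry--Lions regularization of \<open>u\<close>: a sup-convolution followed by an inf-convolution with
  a smaller parameter is semiconvex and semiconcave.\<close>

definition lasry_lions :: "real \<Rightarrow> (real^'n) set \<Rightarrow> real \<Rightarrow> (real^'n \<Rightarrow> real) \<Rightarrow> real^'n \<Rightarrow> real" where
  "lasry_lions k K r u x = - supconv k (cball 0 r) (\<lambda>y. - supconv (k / 2) K u y) x"

context
  fixes K :: "(real^'n) set" and u :: "real^'n \<Rightarrow> real" and k r :: real
  assumes K: "compact K" "K \<noteq> {}" "usc_on K u" and k: "0 < k" and r: "0 < r"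
begin

lemma cball_supconv_usc:
  "compact (cball (0::real^'n) r)" "cball (0::real^'n) r \<noteq> {}" "usc_on (cball 0 r) (\<lambda>y. - supconv (k / 2) K u y)"
  using r k by (auto intro!: continuous_on_imp_usc_on continuous_on_minus supconv_continuous[OF K])

lemma lasry_lions_attained:
  "\<exists>y\<in>cball 0 r. lasry_lions k K r u x = supconv (k / 2) K u y + k * (norm (x - y))\<^sup>2"
  using supconv_attained[OF cball_supconv_usc, of k x] unfolding lasry_lions_def by force

lemma lasry_lions_le:
  "norm y \<le> r \<Longrightarrow> lasry_lions k K r u x \<le> supconv (k / 2) K u y + k * (norm (x - y))\<^sup>2"
  using supconv_ge[OF cball_supconv_usc, of y k x] by (auto simp: lasry_lions_def)

lemma lasry_lions_midpoint:
  "lasry_lions k K r u (x + h) + lasry_lions k K r u (x - h) \<ge> 2 * lasry_lions k K r u x - 2 * k * (norm h)\<^sup>2"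
proof -
  obtain y1 where y1: "norm y1 \<le> r" "lasry_lions k K r u (x + h) = supconv (k / 2) K u y1 + k * (norm (x + h - y1))\<^sup>2"
    using lasry_lions_attained by (metis mem_cball_0)
  obtain y2 where y2: "norm y2 \<le> r" "lasry_lions k K r u (x - h) = supconv (k / 2) K u y2 + k * (norm (x - h - y2))\<^sup>2"
    using lasry_lions_attained by (metis mem_cball_0)
  define y where "y = (1/2) *\<^sub>R (y1 + y2)"
  define e where "e = (1/2) *\<^sub>R (y1 - y2)"
  have y12: "y1 = y + e" "y2 = y - e" by (auto simp: y_def e_def algebra_simps simp flip: scaleR_add_left)
  have "norm y \<le> r" using norm_triangle_ineq[of y1 y2] y1 y2 by (simp add: y_def)
  then have 1: "lasry_lions k K r u x \<le> supconv (k / 2) K u y + k * (norm (x - y))\<^sup>2" by (rule lasry_lions_le)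
  have 2: "supconv (k / 2) K u y1 + supconv (k / 2) K u y2 \<ge> 2 * supconv (k / 2) K u y - k * (norm e)\<^sup>2"
    using supconv_midpoint[OF K, of "k / 2" y e] by (simp add: y12)
  have 3: "(norm (x + h - y1))\<^sup>2 + (norm (x - h - y2))\<^sup>2 = 2 * (norm (x - y))\<^sup>2 + 2 * (norm (h - e))\<^sup>2"
    by (simp add: y12 power2_norm_eq_inner inner_diff_left inner_diff_right inner_add_right inner_add_left inner_commute)
  have "2 * (norm (h - e))\<^sup>2 - (norm e)\<^sup>2 + 2 * (norm h)\<^sup>2 = (norm (e - 2 *\<^sub>R h))\<^sup>2"
    by (simp add: power2_norm_eq_inner inner_diff_left inner_diff_right inner_commute)
  then have "2 * (norm (h - e))\<^sup>2 - (norm e)\<^sup>2 + 2 * (norm h)\<^sup>2 \<ge> 0" by simp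
  then have "k * (2 * (norm (h - e))\<^sup>2 - (norm e)\<^sup>2 + 2 * (norm h)\<^sup>2) \<ge> 0" using k by simp
  moreover have "k * (norm (x + h - y1))\<^sup>2 + k * (norm (x - h - y2))\<^sup>2 = 2 * (k * (norm (x - y))\<^sup>2) + 2 * (k * (norm (h - e))\<^sup>2)"
    using arg_cong[OF 3, of "\<lambda>t. k * t"] by (simp add: algebra_simps)
  ultimately show ?thesis using y1(2) y2(2) 1 2 by (simp add: algebra_simps)
qed

lemma lasry_lions_paraboloids:
  "\<exists>s. \<forall>h. \<bar>lasry_lions k K r u (x + h) - lasry_lions k K r u x - s \<bullet> h\<bar> \<le> 3 * k * (norm h)\<^sup>2"
proof -
  obtain s where "\<And>h. supconv k (cball 0 r) (\<lambda>y. - supconv (k / 2) K u y) (x + h) \<ge>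
      supconv k (cball 0 r) (\<lambda>y. - supconv (k / 2) K u y) x + s \<bullet> h - k * (norm h)\<^sup>2"
    using supconv_lower_paraboloid[OF cball_supconv_usc, of k x] by blast
  then have up: "lasry_lions k K r u (x + h) \<le> lasry_lions k K r u x + (- s) \<bullet> h + k * (norm h)\<^sup>2" for h
    by (simp add: lasry_lions_def) (smt (verit))
  have "\<bar>lasry_lions k K r u (x + h) - lasry_lions k K r u x - (- s) \<bullet> h\<bar> \<le> 3 * k * (norm h)\<^sup>2" for h
  proof -
    have "0 \<le> k * (norm h)\<^sup>2" using k by simp
    then show ?thesis using up[of h] up[of "- h"] lasry_lions_midpoint[of x h] by (simp add: abs_le_iff)
  qed
  then show ?thesis by blast
qed

lemma supconv_le_lasry_lions: "supconv k K u x \<le> lasry_lions k K r u x"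
proof -
  obtain y where y: "norm y \<le> r" "lasry_lions k K r u x = supconv (k / 2) K u y + k * (norm (x - y))\<^sup>2"
    using lasry_lions_attained by (metis mem_cball_0)
  obtain z where z: "z \<in> K" "supconv k K u x = u z - k * (norm (x - z))\<^sup>2" using supconv_attained[OF K] by blast
  have "2 * (norm (x - y))\<^sup>2 + 2 * (norm (x - z))\<^sup>2 - (norm (y - z))\<^sup>2 = (norm ((x - y) + (x - z)))\<^sup>2"
    by (simp only: power2_norm_eq_inner inner_diff_left inner_diff_right inner_add_left inner_add_right inner_commute)
      (simp add: inner_commute)
  then have "2 * (norm (x - y))\<^sup>2 + 2 * (norm (x - z))\<^sup>2 - (norm (y - z))\<^sup>2 \<ge> 0" by simp
  then have "(k / 2) * (2 * (norm (x - y))\<^sup>2 + 2 * (norm (x - z))\<^sup>2 - (norm (y - z))\<^sup>2) \<ge> 0" using k by simp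
  then show ?thesis using supconv_ge[OF K z(1), of "k / 2" y] y z by (simp add: algebra_simps)
qed

text \<open>An inf-convolution plus an affine function is an infimum of paraboloids of the opening used in
  the regularization, so the regularization of \<open>u\<close> stays below it whenever \<open>u\<close>'s
  sup-convolution does.\<close>

lemma lasry_lions_le_infconv:
  assumes v: "usc_on K (\<lambda>x. - v x)" and Kr: "\<And>y. y \<in> K \<Longrightarrow> norm y + 1 \<le> r" and p: "norm p \<le> 2 * k"
    and le: "\<And>x. norm x \<le> r \<Longrightarrow> supconv k K u x \<le> - supconv k K (\<lambda>x. - v x) x + \<alpha> + p \<bullet> x"
  shows "lasry_lions k K r u x \<le> - supconv k K (\<lambda>x. - v x) x + \<alpha> + p \<bullet> x"
proof -
  obtain z where z: "z \<in> K" "supconv k K (\<lambda>x. - v x) x = - v z - k * (norm (x - z))\<^sup>2"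
    using supconv_attained[OF K(1,2) v] by blast
  define y where "y = z - (1 / (2 * k)) *\<^sub>R p"
  have sq: "k * (norm (m - z))\<^sup>2 + p \<bullet> m = k * (norm (m - y))\<^sup>2 + (p \<bullet> z - (norm p)\<^sup>2 / (4 * k))" for m
  proof -
    have "m - y = (m - z) + (1 / (2 * k)) *\<^sub>R p" by (simp add: y_def)
    then have "(norm (m - y))\<^sup>2 = (norm (m - z))\<^sup>2 + (1 / k) * ((m - z) \<bullet> p) + (1 / (2 * k))\<^sup>2 * (norm p)\<^sup>2"
      by (simp only: norm_add_squared norm_scaleR power_mult_distrib inner_scaleR_right power2_abs)
    then have "k * (norm (m - y))\<^sup>2 = k * (norm (m - z))\<^sup>2 + (m - z) \<bullet> p + (norm p)\<^sup>2 / (4 * k)"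
      using k by (simp add: field_simps power2_eq_square)
    then show ?thesis by (simp add: inner_diff_left inner_diff_right inner_commute)
  qed
  have "norm y \<le> norm z + norm p / (2 * k)"
    using norm_triangle_ineq4[of z "(1 / (2 * k)) *\<^sub>R p"] k by (simp add: y_def)
  moreover have "norm p / (2 * k) \<le> 1" using p k by simp
  ultimately have ny: "norm y \<le> r" using Kr[OF z(1)] by simp
  obtain w where w: "w \<in> K" "supconv (k / 2) K u y = u w - k / 2 * (norm (y - w))\<^sup>2" using supconv_attained[OF K] by blast
  define m where "m = (1/2) *\<^sub>R (y + w)"
  have "norm m \<le> r" using norm_triangle_ineq[of y w] ny Kr[OF w(1)] by (simp add: m_def)
  then have 1: "supconv k K u m \<le> - supconv k K (\<lambda>x. - v x) m + \<alpha> + p \<bullet> m" by (rule le)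
  have my: "m - y = (1/2) *\<^sub>R (w - y)" "m - w = (1/2) *\<^sub>R (y - w)"
    by (auto simp: m_def vec_eq_iff field_simps)
  have my2: "(norm (m - y))\<^sup>2 = (norm (y - w))\<^sup>2 / 4" "(norm (m - w))\<^sup>2 = (norm (y - w))\<^sup>2 / 4"
    unfolding my by (auto simp: power_divide norm_minus_commute)
  have 2: "u w - k * ((norm (y - w))\<^sup>2 / 4) \<le> supconv k K u m"
    using supconv_ge[OF K w(1), of k m] my2 by simp
  have 3: "- supconv k K (\<lambda>x. - v x) m \<le> v z + k * (norm (m - z))\<^sup>2"
    using supconv_ge[OF K(1,2) v z(1), of k m] by simp
  have "supconv (k / 2) K u y \<le> v z + \<alpha> + (p \<bullet> z - (norm p)\<^sup>2 / (4 * k))"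
    using 1 2 3 sq[of m] w(2) unfolding my2 by simp
  then show ?thesis using lasry_lions_le[OF ny, of x] sq[of x] z(2) by simp
qed

end

section \<open>Contact points\<close>

text \<open>The inverse of the map from slopes to contact points is Lipschitz, since \<open>w\<close> is squeezed
  between an affine function and a paraboloid at each contact point.\<close>

lemma contact_slopes_estimate:
  fixes w :: "'a::real_inner \<Rightarrow> real"
  assumes c: "0 \<le> c" and e: "0 < e"
    and lower: "\<And>h. w (a + h) \<ge> w a + s \<bullet> h - c * (norm h)\<^sup>2"
    and a: "ball a e \<subseteq> B" "\<And>z. z \<in> B \<Longrightarrow> w z \<le> w a + p \<bullet> (z - a)"
    and b: "ball b e \<subseteq> B" "\<And>z. z \<in> B \<Longrightarrow> w z \<le> w b + p' \<bullet> (z - b)"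
    and ab: "norm (a - b) < e"
  shows "norm (p - p') \<le> 4 * c * norm (a - b)"
proof -
  have small: "x = 0" if "\<And>h. norm h < e \<Longrightarrow> x \<bullet> h \<le> c * (norm h)\<^sup>2" for x :: 'a
  proof (rule ccontr)
    assume x: "x \<noteq> 0"
    define t where "t = min (e / (2 * norm x)) (1 / (2 * (c + 1)))"
    have t: "t > 0" "t * norm x < e" "c * t < 1"
    proof -
      show "t > 0" using e c x by (simp add: t_def)
      have "t * norm x \<le> e / (2 * norm x) * norm x" by (intro mult_right_mono) (auto simp: t_def)
      then show "t * norm x < e" using x e by simp
      have "c * t \<le> c * (1 / (2 * (c + 1)))" using c by (intro mult_left_mono) (auto simp: t_def)
      also have "\<dots> < 1" using c by (simp add: field_simps)
      finally show "c * t < 1" .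
    qed
    have "x \<bullet> (t *\<^sub>R x) \<le> c * (norm (t *\<^sub>R x))\<^sup>2" using t by (intro that) auto
    then have "(t * (norm x)\<^sup>2) * 1 \<le> (t * (norm x)\<^sup>2) * (c * t)"
      using t by (simp add: dot_square_norm power_mult_distrib power2_eq_square mult_ac)
    then have "1 \<le> c * t" using t x by (subst (asm) mult_le_cancel_left_pos) auto
    then show False using t by simp
  qed
  have "(s - p) \<bullet> h \<le> c * (norm h)\<^sup>2" if "norm h < e" for h
  proof -
    have "a + h \<in> B" using a(1) that by (auto simp: dist_norm)
    from a(2)[OF this] lower[of h] show ?thesis by (simp add: inner_diff_left)
  qed
  from small[OF this] have "s = p" by simp
  then have low: "w z \<ge> w a + p \<bullet> (z - a) - c * (norm (z - a))\<^sup>2" for z using lower[of "z - a"] by simp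
  have key: "(p - p') \<bullet> h \<le> c * (norm (b - a + h))\<^sup>2" if "norm h < e" for h
  proof -
    have 1: "b + h \<in> B" "b \<in> B" using b(1) that e by (auto simp: dist_norm)
    show ?thesis using low[of "b + h"] b(2)[OF 1(1)] a(2)[OF 1(2)]
      by (simp add: inner_diff_left inner_diff_right inner_add_right algebra_simps)
  qed
  show ?thesis
  proof (cases "a = b")
    case True
    then have "p - p' = 0" using key by (intro small) simp
    then show ?thesis using c by simp
  next
    case False
    show ?thesis
    proof (cases "p = p'")
      case np: False
      define t where "t = norm (a - b)"
      have t: "t > 0" using False by (simp add: t_def)
      define h where "h = (t / norm (p - p')) *\<^sub>R (p - p')"
      have nh: "norm h = t" using t np by (simp add: h_def)
      have dh: "(p - p') \<bullet> h = t * norm (p - p')"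
        using np by (simp add: h_def power2_norm_eq_inner[symmetric] power2_eq_square)
      have "norm (b - a + h) \<le> 2 * t" using norm_triangle_ineq[of "b - a" h] nh by (simp add: t_def norm_minus_commute)
      then have "c * (norm (b - a + h))\<^sup>2 \<le> c * (2 * t)\<^sup>2" using c by (intro mult_left_mono power_mono) auto
      moreover have "(p - p') \<bullet> h \<le> c * (norm (b - a + h))\<^sup>2" using ab nh by (intro key) (simp add: t_def)
      ultimately have "t * norm (p - p') \<le> t * (4 * c * t)" unfolding dh by (simp add: power2_eq_square algebra_simps)
      then show ?thesis using t by (simp add: t_def)
    qed (use c in simp)
  qed
qed

lemma common_second_order_contact:
  fixes K :: "(real^'n) set"
  assumes K: "compact K" "K \<noteq> {}" and u: "usc_on K u" and v: "usc_on K (\<lambda>x. - v x)"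
    and k: "0 < k" and Kr: "\<And>y. y \<in> K \<Longrightarrow> norm y + 1 \<le> r" and \<delta>: "0 < \<delta>" "\<delta> \<le> 2 * k" and \<tau>: "\<tau> > 0"
    and w: "\<And>x. w x = supconv k K u x + supconv k K (\<lambda>x. - v x) x"
    and inner: "\<And>p x. norm p \<le> \<delta> \<Longrightarrow> norm x \<le> r \<Longrightarrow> (\<And>z. norm z \<le> r \<Longrightarrow> w z \<le> w x + p \<bullet> (z - x)) \<Longrightarrow> norm x < r"
  obtains x p q A d where "norm p \<le> \<delta>" "norm x \<le> r" "\<And>z. norm z \<le> r \<Longrightarrow> w z \<le> w x + p \<bullet> (z - x)"
    "transpose A = A" "d > 0"
    "\<And>h. norm h < d \<Longrightarrow> supconv k K u (x + h) \<le> supconv k K u x + q \<bullet> h + (h \<bullet> (A *v h)) / 2 + \<tau> * (norm h)\<^sup>2"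
    "\<And>h. norm h < d \<Longrightarrow> supconv k K (\<lambda>x. - v x) (x + h) \<le>
       supconv k K (\<lambda>x. - v x) x - (q - p) \<bullet> h - (h \<bullet> (A *v h)) / 2 + \<tau> * (norm h)\<^sup>2"
proof -
  obtain y0 where "y0 \<in> K" using K(2) by blast
  then have r: "r > 0" using Kr[of y0] norm_ge_zero[of y0] by linarith
  have wcont: "continuous_on (cball 0 r) w"
    unfolding w using k by (intro continuous_on_add supconv_continuous K u v) auto
  have "\<exists>x. norm x \<le> r \<and> (\<forall>z. norm z \<le> r \<longrightarrow> w z \<le> w x + p \<bullet> (z - x))" for p
  proof -
    have "continuous_on (cball 0 r) (\<lambda>x. w x - p \<bullet> x)" by (intro continuous_intros wcont)
    then obtain x where "x \<in> cball 0 r" "\<forall>z\<in>cball 0 r. w z - p \<bullet> z \<le> w x - p \<bullet> x"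
      using continuous_attains_sup[of "cball 0 r" "\<lambda>x. w x - p \<bullet> x"] r by auto
    then show ?thesis by (intro exI[of _ x]) (auto simp: inner_diff_right algebra_simps)
  qed
  then obtain X where X: "\<And>p. norm (X p) \<le> r" "\<And>p z. norm z \<le> r \<Longrightarrow> w z \<le> w (X p) + p \<bullet> (z - X p)" by metis
  have Xr: "norm (X p) < r" if "norm p \<le> \<delta>" for p using inner[OF that X(1)] X(2) by blast
  have low: "\<exists>s. \<forall>h. w (x + h) \<ge> w x + s \<bullet> h - (2 * k) * (norm h)\<^sup>2" for x
  proof -
    obtain s1 where s1: "\<And>h. supconv k K u (x + h) \<ge> supconv k K u x + s1 \<bullet> h - k * (norm h)\<^sup>2"
      using supconv_lower_paraboloid[OF K u] by blast
    obtain s2 where s2: "\<And>h. supconv k K (\<lambda>x. - v x) (x + h) \<ge> supconv k K (\<lambda>x. - v x) x + s2 \<bullet> h - k * (norm h)\<^sup>2"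
      using supconv_lower_paraboloid[OF K v] by blast
    show ?thesis
    proof (intro exI[of _ "s1 + s2"] allI)
      fix h
      show "w (x + h) \<ge> w x + (s1 + s2) \<bullet> h - (2 * k) * (norm h)\<^sup>2"
        unfolding w using s1[of h] s2[of h] by (simp add: inner_add_left)
    qed
  qed
  have lip: "norm (p - p') \<le> 8 * k * norm (X p - X p')"
    if p: "norm p \<le> \<delta>" "norm p' \<le> \<delta>" and e: "e > 0" "e \<le> (r - norm (X p')) / 2" "norm (X p - X p') < e" for p p' e
  proof -
    obtain s where s: "\<And>h. w (X p + h) \<ge> w (X p) + s \<bullet> h - (2 * k) * (norm h)\<^sup>2" using low by blast
    have sub: "ball (X p') e \<subseteq> cball 0 r" "ball (X p) e \<subseteq> cball 0 r"
    proof -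
      show "ball (X p') e \<subseteq> cball 0 r"
      proof
        fix z assume "z \<in> ball (X p') e"
        then have "norm (X p' - z) < e" by (simp add: dist_norm)
        then show "z \<in> cball 0 r" using e norm_triangle_sub[of z "X p'"] by (simp add: norm_minus_commute)
      qed
      show "ball (X p) e \<subseteq> cball 0 r"
      proof
        fix z assume "z \<in> ball (X p) e"
        then have "norm (X p - z) < e" by (simp add: dist_norm)
        then show "z \<in> cball 0 r"
          using e norm_triangle_sub[of z "X p"] norm_triangle_sub[of "X p" "X p'"] by (simp add: norm_minus_commute)
      qed
    qed
    have "norm (p - p') \<le> 4 * (2 * k) * norm (X p - X p')"
      by (rule contact_slopes_estimate[OF _ e(1) s sub(2) _ sub(1) _ e(3)]) (use k X in auto)
    then show ?thesis by simp
  qed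
  have inj: "inj_on X (cball 0 \<delta>)"
  proof (rule inj_onI)
    fix p p' assume p: "p \<in> cball 0 \<delta>" "p' \<in> cball 0 \<delta>" "X p = X p'"
    then show "p = p'" using lip[of p p' "(r - norm (X p')) / 2"] Xr[of p'] by simp
  qed
  define P where "P = inv_into (cball 0 \<delta>) X"
  have PX: "P (X p) = p" if "norm p \<le> \<delta>" for p using inj that by (simp add: P_def inv_into_f_f)
  define E where "E = X ` cball 0 \<delta>"
  have "\<not> negligible E"
  proof
    assume "negligible E"
    then have "negligible (P ` E)"
    proof (rule negligible_locally_Lipschitz_image[rotated])
      fix x assume "x \<in> E"
      then obtain p' where p': "norm p' \<le> \<delta>" "x = X p'" by (auto simp: E_def)
      define e where "e = (r - norm x) / 2"
      have "e > 0" using Xr p' by (simp add: e_def)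
      moreover have "norm (P y - P x) \<le> 8 * k * norm (y - x)" if y: "y \<in> E \<inter> ball x e" for y
      proof -
        obtain p where p: "norm p \<le> \<delta>" "y = X p" using y by (auto simp: E_def)
        then show ?thesis using lip[OF p(1) p'(1) \<open>e > 0\<close>] y p' PX
          by (auto simp: e_def dist_norm norm_minus_commute)
      qed
      ultimately show "\<exists>T B. open T \<and> x \<in> T \<and> (\<forall>y\<in>E \<inter> T. norm (P y - P x) \<le> B * norm (y - x))"
        by (intro exI[of _ "ball x e"] exI[of _ "8 * k"]) auto
    qed simp
    moreover have "P ` E = cball 0 \<delta>" using PX by (force simp: E_def image_image)
    ultimately have "negligible (cball (0::real^'n) \<delta>)" by simp
    then show False using \<delta> negligible_imp_measure0 content_cball_pos[of \<delta> "0::real^'n"] by fastforce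
  qed
  define f where "f = lasry_lions k K r u"
  have "\<exists>s. \<forall>h. \<bar>f (x + h) - f x - s \<bullet> h\<bar> \<le> 3 * k * (norm h)\<^sup>2" for x
    unfolding f_def by (rule lasry_lions_paraboloids[OF K u k r])
  then obtain g where g: "\<And>x h. \<bar>f (x + h) - f x - g x \<bullet> h\<bar> \<le> 3 * k * (norm h)\<^sup>2" by metis
  have neg: "negligible {x. \<not> (\<exists>A d. transpose A = A \<and> d > 0 \<and> (\<forall>h. norm h < d \<longrightarrow>
    \<bar>f (x + h) - f x - g x \<bullet> h - (h \<bullet> (A *v h)) / 2\<bar> \<le> \<tau> * (norm h)\<^sup>2))}"
    using k by (intro approx_second_order_ae[OF _ g \<tau>]) simp
  have "\<not> E \<subseteq> {x. \<not> (\<exists>A d. transpose A = A \<and> d > 0 \<and> (\<forall>h. norm h < d \<longrightarrow>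
    \<bar>f (x + h) - f x - g x \<bullet> h - (h \<bullet> (A *v h)) / 2\<bar> \<le> \<tau> * (norm h)\<^sup>2))}"
    using negligible_subset[OF neg] \<open>\<not> negligible E\<close> by blast
  then obtain x where x: "x \<in> E" "\<exists>A d. transpose A = A \<and> d > 0 \<and> (\<forall>h. norm h < d \<longrightarrow>
    \<bar>f (x + h) - f x - g x \<bullet> h - (h \<bullet> (A *v h)) / 2\<bar> \<le> \<tau> * (norm h)\<^sup>2)"
    unfolding subset_iff mem_Collect_eq by blast
  obtain A d where A: "transpose A = A" "d > 0"
    and fA: "\<And>h. norm h < d \<Longrightarrow> \<bar>f (x + h) - f x - g x \<bullet> h - (h \<bullet> (A *v h)) / 2\<bar> \<le> \<tau> * (norm h)\<^sup>2"
    using x(2) by blast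
  obtain p where p: "norm p \<le> \<delta>" "x = X p" using x(1) by (auto simp: E_def)
  define \<alpha> where "\<alpha> = w x - p \<bullet> x"
  have ge: "supconv k K u z \<le> f z" for z unfolding f_def by (rule supconv_le_lasry_lions[OF K u k r])
  have le: "f z \<le> - supconv k K (\<lambda>x. - v x) z + \<alpha> + p \<bullet> z" for z
    unfolding f_def
  proof (rule lasry_lions_le_infconv[OF K u k r v Kr])
    show "norm p \<le> 2 * k" using p \<delta> by simp
    show "supconv k K u y \<le> - supconv k K (\<lambda>x. - v x) y + \<alpha> + p \<bullet> y" if "norm y \<le> r" for y
      using X(2)[OF that, of p] unfolding p(2)[symmetric] w[of y] by (simp add: \<alpha>_def inner_diff_right)
  qed auto
  have fx: "f x = supconv k K u x" using ge[of x] le[of x] by (simp add: \<alpha>_def w)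
  show ?thesis
  proof (rule that[OF p(1), of x A d "g x"])
    show "norm x \<le> r" using X p by simp
    show "w z \<le> w x + p \<bullet> (z - x)" if "norm z \<le> r" for z using X(2)[OF that] p by simp
    show "supconv k K u (x + h) \<le> supconv k K u x + g x \<bullet> h + (h \<bullet> (A *v h)) / 2 + \<tau> * (norm h)\<^sup>2" if "norm h < d" for h
      using fA[OF that] ge[of "x + h"] fx by linarith
    show "supconv k K (\<lambda>x. - v x) (x + h) \<le>
       supconv k K (\<lambda>x. - v x) x - (g x - p) \<bullet> h - (h \<bullet> (A *v h)) / 2 + \<tau> * (norm h)\<^sup>2" if "norm h < d" for h
    proof -
      have "supconv k K (\<lambda>x. - v x) (x + h) \<le> \<alpha> + p \<bullet> (x + h) - f (x + h)" using le[of "x + h"] by simp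
      moreover have "\<alpha> + p \<bullet> x = supconv k K u x + supconv k K (\<lambda>x. - v x) x" by (simp add: \<alpha>_def w)
      ultimately show ?thesis using fA[OF that] fx by (simp add: inner_diff_left inner_add_right abs_le_iff)
    qed
  qed (use A in auto)
qed

section \<open>The comparison principle\<close>

lemma quadratic_C2_on_with:
  fixes M :: "real^'n^'n"
  assumes M: "transpose M = M" and U: "open U"
  shows "C2_on_with U (\<lambda>y. \<alpha> + q \<bullet> (y - y0) + ((y - y0) \<bullet> (M *v (y - y0))) / 2) (\<lambda>y. q + M *v (y - y0)) (\<lambda>_. M)"
  unfolding C2_on_with_def
proof (intro conjI ballI U continuous_on_const)
  fix x assume "x \<in> U"
  have bl: "bounded_linear ((*v) M)" by (rule matrix_vector_mul_bounded_linear)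
  have dM: "((\<lambda>y. M *v (y - y0)) has_derivative (\<lambda>h. M *v h)) (at x)"
  proof (rule has_derivative_eq_rhs[OF bounded_linear.has_derivative[OF bl]])
    show "((\<lambda>y. y - y0) has_derivative (\<lambda>h. h)) (at x)" by (auto intro!: derivative_eq_intros)
  qed simp
  have sym: "z \<bullet> (M *v h) = (M *v z) \<bullet> h" for z h
    using M by (metis dot_lmul_matrix transpose_matrix_vector)
  show "((\<lambda>y. \<alpha> + q \<bullet> (y - y0) + ((y - y0) \<bullet> (M *v (y - y0))) / 2) has_derivative
    (\<lambda>h. (q + M *v (x - y0)) \<bullet> h)) (at x)"
  proof -
    have d0: "((\<lambda>y. y - y0) has_derivative (\<lambda>h. h)) (at x)" by (auto intro!: derivative_eq_intros)
    have dq: "((\<lambda>y. \<alpha> + q \<bullet> (y - y0)) has_derivative (\<lambda>h. q \<bullet> h)) (at x)" by (auto intro!: derivative_eq_intros)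
    have d2: "((\<lambda>y. ((y - y0) \<bullet> (M *v (y - y0))) / 2) has_derivative (\<lambda>h. (M *v (x - y0)) \<bullet> h)) (at x)"
      by (rule has_derivative_eq_rhs[OF bounded_linear.has_derivative[OF bounded_linear_divide has_derivative_inner[OF d0 dM]]])
        (simp add: fun_eq_iff sym inner_commute)
    show ?thesis by (rule has_derivative_eq_rhs[OF has_derivative_add[OF dq d2]]) (simp add: inner_add_left)
  qed
  show "((\<lambda>y. q + M *v (y - y0)) has_derivative (\<lambda>h. M *v h)) (at x)"
    by (rule has_derivative_eq_rhs[OF has_derivative_add[OF has_derivative_const dM]]) simp
qed

lemma JplusI_quadratic:
  assumes M: "transpose M = M" and d: "d > 0"
    and le: "\<And>h. norm h < d \<Longrightarrow> u (y + h) \<le> u y + q \<bullet> h + (h \<bullet> (M *v h)) / 2"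
  shows "(u y, M) \<in> Jplus u y"
proof -
  let ?\<phi> = "\<lambda>x. u y + q \<bullet> (x - y) + ((x - y) \<bullet> (M *v (x - y))) / 2"
  have C2: "C2_on_with (ball y d) ?\<phi> (\<lambda>x. q + M *v (x - y)) (\<lambda>_. M)"
    by (rule quadratic_C2_on_with[OF M open_ball])
  have touch: "u x \<le> ?\<phi> x" if "x \<in> ball y d" for x
    using le[of "x - y"] that by (simp add: dist_norm norm_minus_commute)
  show ?thesis unfolding Jplus_def mem_Collect_eq
    by (rule exI[of _ ?\<phi>], rule exI[of _ "\<lambda>x. q + M *v (x - y)"], rule exI[of _ "\<lambda>_. M"])
      (use d C2 touch in \<open>auto intro!: exI[of _ "ball y d"]\<close>)
qed

lemma JminusI_quadratic:
  assumes M: "transpose M = M" and d: "d > 0"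
    and le: "\<And>h. norm h < d \<Longrightarrow> v y + q \<bullet> h + (h \<bullet> (M *v h)) / 2 \<le> v (y + h)"
  shows "(v y, M) \<in> Jminus v y"
proof -
  let ?\<phi> = "\<lambda>x. v y + q \<bullet> (x - y) + ((x - y) \<bullet> (M *v (x - y))) / 2"
  have C2: "C2_on_with (ball y d) ?\<phi> (\<lambda>x. q + M *v (x - y)) (\<lambda>_. M)"
    by (rule quadratic_C2_on_with[OF M open_ball])
  have touch: "?\<phi> x \<le> v x" if "x \<in> ball y d" for x
    using le[of "x - y"] that by (simp add: dist_norm norm_minus_commute)
  show ?thesis unfolding Jminus_def mem_Collect_eq
    by (rule exI[of _ ?\<phi>], rule exI[of _ "\<lambda>x. q + M *v (x - y)"], rule exI[of _ "\<lambda>_. M"])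
      (use d C2 touch in \<open>auto intro!: exI[of _ "ball y d"]\<close>)
qed

lemma norm_matrix_vector_mult_le:
  fixes D :: "real^'n^'m"
  shows "norm (D *v x) \<le> norm D * norm x"
proof -
  have "norm (D *v x) = L2_set (\<lambda>i. \<bar>(D *v x) $ i\<bar>) UNIV" by (simp add: norm_vec_def)
  also have "\<dots> \<le> L2_set (\<lambda>i. norm (D $ i) * norm x) UNIV"
    by (intro L2_set_mono) (auto simp: matrix_vector_mul_component Cauchy_Schwarz_ineq2)
  also have "\<dots> = norm D * norm x" by (simp add: norm_vec_def L2_set_left_distrib)
  finally show ?thesis .
qed

lemma inner_scaled_identity: "\<xi> \<bullet> ((c *\<^sub>R mat 1) *v \<xi>) = c * (norm \<xi>)\<^sup>2" for \<xi> :: "real^'n"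
  by (simp add: scaleR_matrix_vector_assoc[symmetric] power2_norm_eq_inner)

lemma transpose_add_identity: "transpose A = A \<Longrightarrow> transpose (A + c *\<^sub>R mat 1) = A + c *\<^sub>R mat 1" for A :: "real^'n^'n"
  by (simp add: transpose_def vec_eq_iff mat_def)

lemma interior_of_elliptic:
  fixes A :: "real^'n^'n"
  assumes ell: "\<And>a q. a \<in> T \<Longrightarrow> q \<in> Qcone \<Longrightarrow> a + q \<in> T"
    and A: "transpose A = A" and mem: "(t, A + c *\<^sub>R mat 1) \<in> T" and st: "s < t" and cd: "c < c'"
  shows "(s, A + c' *\<^sub>R mat 1) \<in> (top_of_set RS) interior_of T"
proof -
  let ?A' = "A + c' *\<^sub>R mat 1"
  define V where "V = {..<t} \<times> ball ?A' (c' - c)"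
  have "openin (top_of_set RS) (RS \<inter> V)" by (intro openin_open_Int) (simp add: V_def open_Times)
  moreover have "(s, ?A') \<in> RS \<inter> V"
    using st cd transpose_add_identity[OF A] by (auto simp: V_def RS_def SymM_def)
  moreover have "RS \<inter> V \<subseteq> T"
  proof clarify
    fix s' B assume sB: "(s', B) \<in> RS" "(s', B) \<in> V"
    then have B: "transpose B = B" "s' < t" "norm (B - ?A') < c' - c"
      by (auto simp: V_def RS_def SymM_def dist_norm norm_minus_commute)
    define P where "P = B - (A + c *\<^sub>R mat 1)"
    have "psd P" unfolding psd_def
    proof (intro conjI allI)
      show "P \<in> SymM"
        using B(1) transpose_add_identity[OF A, of c]
        by (simp add: P_def SymM_def transpose_def vec_eq_iff)
      fix \<xi> :: "real^'n"
      have "P = (B - ?A') + (c' - c) *\<^sub>R mat 1" by (simp add: P_def scaleR_diff_left)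
      then have "\<xi> \<bullet> (P *v \<xi>) = \<xi> \<bullet> ((B - ?A') *v \<xi>) + (c' - c) * (norm \<xi>)\<^sup>2"
        by (simp only: matrix_vector_mult_add_rdistrib inner_add_right inner_scaled_identity)
      moreover have "\<bar>\<xi> \<bullet> ((B - ?A') *v \<xi>)\<bar> \<le> norm \<xi> * (norm (B - ?A') * norm \<xi>)"
        by (rule order_trans[OF Cauchy_Schwarz_ineq2 mult_left_mono[OF norm_matrix_vector_mult_le]]) simp
      moreover have "norm \<xi> * (norm (B - ?A') * norm \<xi>) \<le> norm \<xi> * ((c' - c) * norm \<xi>)"
        using B by (intro mult_left_mono mult_right_mono) auto
      ultimately show "0 \<le> \<xi> \<bullet> (P *v \<xi>)" by (simp add: power2_eq_square algebra_simps)
    qed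
    then have "(s' - t, P) \<in> Qcone" using B by (simp add: Qcone_def)
    from ell[OF mem this] show "(s', B) \<in> T" by (simp add: P_def)
  qed
  ultimately show ?thesis unfolding interior_of_def by blast
qed

lemma usc_boundary_separation:
  fixes u v :: "real^'n \<Rightarrow> real"
  assumes K: "compact K" and F: "closed F" "F \<noteq> {}" and u: "usc_on K u" and v: "lsc_on K v"
    and less: "\<And>y. y \<in> K \<Longrightarrow> y \<in> F \<Longrightarrow> u y - v y < c"
  shows "\<exists>r>0. \<forall>y\<in>K. \<forall>z\<in>K. u y - v z \<ge> c \<longrightarrow> dist y z < r \<longrightarrow> 2 * r < infdist y F"
proof (rule ccontr)
  assume neg: "\<not> ?thesis"
  have "\<exists>y z. y \<in> K \<and> z \<in> K \<and> u y - v z \<ge> c \<and> dist y z < 1 / Suc n \<and> infdist y F \<le> 2 * (1 / Suc n)" for n :: nat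
  proof -
    have "1 / real (Suc n) > 0" by simp
    with neg show ?thesis by (meson not_le)
  qed
  then obtain Y Z where YZ: "\<And>n::nat. Y n \<in> K" "\<And>n. Z n \<in> K" "\<And>n. u (Y n) - v (Z n) \<ge> c"
    "\<And>n. dist (Y n) (Z n) < 1 / Suc n" "\<And>n. infdist (Y n) F \<le> 2 * (1 / Suc n)" by metis
  obtain y \<sigma> where y: "y \<in> K" "strict_mono \<sigma>" "(Y \<circ> \<sigma>) \<longlonglongrightarrow> y"
    using K YZ(1) unfolding compact_def by metis
  have inv: "(\<lambda>n. 1 / real (Suc (\<sigma> n))) \<longlonglongrightarrow> 0"
    using LIMSEQ_subseq_LIMSEQ[OF LIMSEQ_inverse_real_of_nat y(2)] by (simp add: o_def inverse_eq_divide)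
  have Y: "(\<lambda>n. Y (\<sigma> n)) \<longlonglongrightarrow> y" using y(3) by (simp add: o_def)
  have "(\<lambda>n. dist (Y (\<sigma> n)) (Z (\<sigma> n))) \<longlonglongrightarrow> 0"
    by (rule tendsto_sandwich[OF _ _ tendsto_const inv]) (use YZ(4) less_imp_le in \<open>auto intro!: always_eventually\<close>)
  then have Z: "(\<lambda>n. Z (\<sigma> n)) \<longlonglongrightarrow> y" using Lim_transform_eq[of "\<lambda>n. Y (\<sigma> n)" "\<lambda>n. Z (\<sigma> n)"] Y
    by (simp add: dist_norm tendsto_norm_zero_iff)
  have "(\<lambda>n. infdist (Y (\<sigma> n)) F) \<longlonglongrightarrow> 0"
  proof (rule tendsto_sandwich[OF _ _ tendsto_const])
    show "(\<lambda>n. 2 * (1 / real (Suc (\<sigma> n)))) \<longlonglongrightarrow> 0" using tendsto_mult_left[OF inv, of 2] by simp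
  qed (use YZ(5) in \<open>auto intro!: always_eventually simp: infdist_nonneg\<close>)
  moreover have "(\<lambda>n. infdist (Y (\<sigma> n)) F) \<longlonglongrightarrow> infdist y F" using Y by (rule tendsto_infdist)
  ultimately have "infdist y F = 0" using LIMSEQ_unique by blast
  then have "y \<in> F" using F in_closed_iff_infdist_zero by blast
  from less[OF y(1) this] have "u y < c + v y" by simp
  then obtain t where t: "u y < t" "t < c + v y" using dense by blast
  have "openin (top_of_set K) {x\<in>K. u x < t}" using u by (simp add: usc_on_def)
  then obtain T1 where T1: "open T1" "{x\<in>K. u x < t} = K \<inter> T1" by (auto simp: openin_open)
  have "openin (top_of_set K) {x\<in>K. v x > t - c}" using v by (simp add: lsc_on_def)
  then obtain T2 where T2: "open T2" "{x\<in>K. v x > t - c} = K \<inter> T2" by (auto simp: openin_open)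
  have "y \<in> T1" using T1(2) t y(1) by blast
  then have "\<forall>\<^sub>F n in sequentially. Y (\<sigma> n) \<in> T1" using topological_tendstoD[OF Y T1(1)] by blast
  moreover have "y \<in> {x\<in>K. v x > t - c}" using t y(1) by simp
  then have "y \<in> T2" using T2(2) by blast
  then have "\<forall>\<^sub>F n in sequentially. Z (\<sigma> n) \<in> T2" using topological_tendstoD[OF Z T2(1)] by blast
  ultimately have "\<forall>\<^sub>F n in sequentially. Y (\<sigma> n) \<in> T1 \<and> Z (\<sigma> n) \<in> T2" by (rule eventually_conj)
  then obtain n where "Y (\<sigma> n) \<in> T1" "Z (\<sigma> n) \<in> T2" using eventually_happens by fastforce
  then have "Y (\<sigma> n) \<in> {x\<in>K. u x < t}" "Z (\<sigma> n) \<in> {x\<in>K. v x > t - c}" using T1(2) T2(2) YZ(1,2) by blast+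
  then show False using YZ(3)[of "\<sigma> n"] by simp
qed

theorem theorem5p7:
  fixes \<Omega> :: "(real^'n) set"
    and \<Theta> :: "real^'n \<Rightarrow> (real \<times> (real^'n^'n)) set"
    and u v :: "real^'n \<Rightarrow> real"
  assumes "bounded \<Omega>" and "open \<Omega>" and "connected \<Omega>"
    and "proper_elliptic_map \<Omega> \<Theta>"
    and "\<forall>X. open X \<and> compactly_contained X \<Omega> \<longrightarrow>
           (\<exists>R0. \<forall>R. R > 0 \<and> R \<ge> R0 \<longrightarrow>
              (\<forall>\<eta>>0. \<exists>\<delta>>0. \<forall>x\<in>X. \<forall>y\<in>X. dist x y < \<delta> \<longrightarrow>
                 (\<lambda>(r, A). (r, A + \<eta> *\<^sub>R mat 1)) ` (\<Theta> x \<inter> ({-R..R} \<times> SymM)) \<subseteq> \<Theta> y))"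
    and "usc_on (closure \<Omega>) u" and "Theta_subharmonic \<Theta> \<Omega> u"
    and "lsc_on (closure \<Omega>) v" and "Theta_superharmonic \<Theta> \<Omega> v"
    and "\<forall>x\<in>frontier \<Omega>. u x \<le> v x"
  shows "\<forall>x\<in>\<Omega>. u x \<le> v x"
proof (rule ccontr)
  assume "\<not> (\<forall>x\<in>\<Omega>. u x \<le> v x)"
  then obtain x0 where x0: "x0 \<in> \<Omega>" "v x0 < u x0" by (auto simp: not_le)
  define K where "K = closure \<Omega>"
  have K: "compact K" "K \<noteq> {}" using assms(1) x0 by (auto simp: K_def)
  have \<Omega>K: "\<Omega> \<subseteq> K" by (simp add: K_def closure_subset)
  obtain \<rho> where \<rho>: "\<rho> > 0" "\<And>y. y \<in> K \<Longrightarrow> norm y \<le> \<rho>"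
    using compact_imp_bounded[OF K(1)] bounded_pos by blast
  define \<kappa> where "\<kappa> = (u x0 - v x0) / \<rho>\<^sup>2"
  have \<kappa>: "\<kappa> > 0" using x0 \<rho> by (simp add: \<kappa>_def)
  define m where "m = (u x0 - v x0) / 2"
  have m: "m > 0" using x0 by (simp add: m_def)
  define u' where "u' x = u x + \<kappa> / 2 * ((norm x)\<^sup>2 - \<rho>\<^sup>2)" for x
  have u'x0: "u' x0 - v x0 \<ge> m"
  proof -
    have "\<kappa> / 2 * ((norm x0)\<^sup>2 - \<rho>\<^sup>2) \<ge> \<kappa> / 2 * (0 - \<rho>\<^sup>2)" using \<kappa> by (intro mult_left_mono) auto
    moreover have "\<kappa> / 2 * (0 - \<rho>\<^sup>2) = - m" using \<rho> by (simp add: \<kappa>_def m_def)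
    ultimately show ?thesis by (simp add: u'_def m_def)
  qed
  have u'le: "u' y \<le> u y" if "y \<in> K" for y
  proof -
    have "(norm y)\<^sup>2 \<le> \<rho>\<^sup>2" using \<rho>(2)[OF that] by (intro power_mono) auto
    then have "\<kappa> / 2 * ((norm y)\<^sup>2 - \<rho>\<^sup>2) \<le> 0" using \<kappa> by (intro mult_nonneg_nonpos) auto
    then show ?thesis by (simp add: u'_def)
  qed
  have usc: "usc_on K u'" unfolding u'_def
    using assms(6) by (intro usc_on_add_continuous continuous_intros) (simp add: K_def)
  have lsc: "lsc_on K v" using assms(8) by (simp add: K_def)
  have uscv: "usc_on K (\<lambda>x. - v x)"
    using lsc unfolding usc_on_def lsc_on_def by (metis (no_types, lifting) Collect_cong minus_less_iff)
  obtain Mu where Mu: "\<And>y. y \<in> K \<Longrightarrow> u' y \<le> Mu" using usc_on_attains_sup[OF K usc] by blast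
  obtain Mv where Mv: "\<And>y. y \<in> K \<Longrightarrow> - v y \<le> Mv" using usc_on_attains_sup[OF K uscv] by blast
  define F where "F = - \<Omega>"
  have "\<Omega> \<noteq> UNIV" using assms(1) not_bounded_UNIV by auto
  then have F: "closed F" "F \<noteq> {}" using assms(2) unfolding F_def by blast+
  have "u' y - v y < m / 2" if "y \<in> K" "y \<in> F" for y
  proof -
    have "y \<in> frontier \<Omega>" using that assms(2) by (simp add: K_def F_def frontier_def interior_open)
    then have "u y \<le> v y" using assms(10) by blast
    then show ?thesis using u'le[OF that(1)] m by simp
  qed
  from usc_boundary_separation[OF K(1) F usc lsc this]
  obtain r0 where r0: "r0 > 0" "\<And>y z. y \<in> K \<Longrightarrow> z \<in> K \<Longrightarrow> u' y - v z \<ge> m / 2 \<Longrightarrow> dist y z < r0 \<Longrightarrow> 2 * r0 < infdist y F"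
    by blast
  define X where "X = {x. r0 < infdist x F}"
  have in\<Omega>: "x \<in> \<Omega>" if "infdist x F > 0" for x
  proof (rule ccontr)
    assume "x \<notin> \<Omega>"
    then have "infdist x F = 0" by (intro infdist_zero) (simp add: F_def)
    then show False using that by simp
  qed
  have X\<Omega>: "X \<subseteq> \<Omega>" using in\<Omega> r0 by (force simp: X_def)
  have "open X" unfolding X_def by (intro open_Collect_less continuous_intros)
  moreover have "compactly_contained X \<Omega>" unfolding compactly_contained_def
  proof
    show "compact (closure X)" using bounded_subset[OF assms(1) X\<Omega>] by simp
    have "closed {x. r0 \<le> infdist x F}" by (intro closed_Collect_le continuous_intros)
    then have "closure X \<subseteq> {x. r0 \<le> infdist x F}" by (intro closure_minimal) (auto simp: X_def)
    then show "closure X \<subseteq> \<Omega>" using in\<Omega> r0 by force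
  qed
  ultimately obtain R0 where R0: "\<And>R \<eta>. R > 0 \<Longrightarrow> R \<ge> R0 \<Longrightarrow> \<eta> > 0 \<Longrightarrow> \<exists>\<delta>>0. \<forall>x\<in>X. \<forall>y\<in>X. dist x y < \<delta> \<longrightarrow>
      (\<lambda>(r, A). (r, A + \<eta> *\<^sub>R mat 1)) ` (\<Theta> x \<inter> ({-R..R} \<times> SymM)) \<subseteq> \<Theta> y"
    using assms(5) by meson
  define R where "R = max R0 (1 + \<bar>Mu\<bar> + \<bar>Mv\<bar>)"
  have R: "R > 0" "R \<ge> R0" "R \<ge> \<bar>Mu\<bar>" "R \<ge> \<bar>Mv\<bar>" by (auto simp: R_def)
  have "\<kappa> / 4 > 0" using \<kappa> by simp
  from R0[OF R(1,2) this] obtain \<delta>c where \<delta>c: "\<delta>c > 0" and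
    cont: "\<And>x y. x \<in> X \<Longrightarrow> y \<in> X \<Longrightarrow> dist x y < \<delta>c \<Longrightarrow>
      (\<lambda>(r, A). (r, A + (\<kappa> / 4) *\<^sub>R mat 1)) ` (\<Theta> x \<inter> ({-R..R} \<times> SymM)) \<subseteq> \<Theta> y" by blast
  define s where "s = min 1 (min r0 \<delta>c) / 2"
  have s: "s > 0" "2 * s \<le> 1" "2 * s \<le> r0" "2 * s \<le> \<delta>c" using r0 \<delta>c by (auto simp: s_def)
  define M0 where "M0 = \<bar>Mu\<bar> + \<bar>Mv\<bar> + 1"
  define k where "k = 2 * M0 / s\<^sup>2"
  have k: "k > 0" using s by (simp add: k_def M0_def)
  define r where "r = \<rho> + 1"
  define \<delta> where "\<delta> = min (2 * k) (m / (4 * r))"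
  have r: "r > 0" using \<rho> by (simp add: r_def)
  have \<delta>: "\<delta> > 0" "\<delta> \<le> 2 * k" using k m r by (auto simp: \<delta>_def)
  define w where "w x = supconv k K u' x + supconv k K (\<lambda>x. - v x) x" for x
  have near: "norm (x - y) < s \<and> norm (x - z) < s \<and> u' y - v z \<ge> m / 2"
    if "norm p \<le> \<delta>" "norm x \<le> r" "\<And>z. norm z \<le> r \<Longrightarrow> w z \<le> w x + p \<bullet> (z - x)"
      "y \<in> K" "supconv k K u' x = u' y - k * (norm (x - y))\<^sup>2"
      "z \<in> K" "supconv k K (\<lambda>x. - v x) x = - v z - k * (norm (x - z))\<^sup>2" for p x y z
  proof -
    have x0K: "x0 \<in> K" using x0 \<Omega>K by blast
    have x0r: "norm x0 \<le> r" using \<rho>(2)[OF x0K] by (simp add: r_def)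
    have "w x0 \<ge> m" using supconv_ge[OF K usc x0K, of k x0] supconv_ge[OF K uscv x0K, of k x0] u'x0 by (simp add: w_def)
    moreover have "w x0 \<le> w x + p \<bullet> (x0 - x)" by (rule that(3)[OF x0r])
    moreover have "p \<bullet> (x0 - x) \<le> m / 2"
    proof -
      have "p \<bullet> (x0 - x) \<le> norm p * norm (x0 - x)" by (rule norm_cauchy_schwarz)
      also have "\<dots> \<le> (m / (4 * r)) * (2 * r)"
        using that(1,2) x0r m r norm_triangle_ineq4[of x0 x] by (intro mult_mono) (auto simp: \<delta>_def)
      also have "\<dots> = m / 2" using r by simp
      finally show ?thesis .
    qed
    ultimately have wx: "u' y - v z - k * (norm (x - y))\<^sup>2 - k * (norm (x - z))\<^sup>2 \<ge> m / 2"
      using that(5,7) by (simp add: w_def)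
    have pos: "k * (norm (x - y))\<^sup>2 \<ge> 0" "k * (norm (x - z))\<^sup>2 \<ge> 0" using k by auto
    have small: "norm a < s" if "k * (norm a)\<^sup>2 \<le> M0" for a :: "real^'n"
    proof (rule power2_less_imp_less)
      have "(2 * M0) * (norm a)\<^sup>2 \<le> M0 * s\<^sup>2" using that s by (simp add: k_def field_simps)
      then have "M0 * (2 * (norm a)\<^sup>2) \<le> M0 * s\<^sup>2" by simp
      then have "2 * (norm a)\<^sup>2 \<le> s\<^sup>2" by (subst (asm) mult_le_cancel_left_pos) (auto simp: M0_def)
      moreover have "s\<^sup>2 > 0" using s by simp
      ultimately show "(norm a)\<^sup>2 < s\<^sup>2" by linarith
    qed (use s in simp)
    have "u' y - v z \<le> M0" using Mu[OF that(4)] Mv[OF that(6)] by (simp add: M0_def)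
    then show ?thesis using wx pos m by (auto intro!: small)
  qed
  have inner: "norm x < r" if px: "norm p \<le> \<delta>" "norm x \<le> r" "\<And>z. norm z \<le> r \<Longrightarrow> w z \<le> w x + p \<bullet> (z - x)" for p x
  proof -
    obtain y where y: "y \<in> K" "supconv k K u' x = u' y - k * (norm (x - y))\<^sup>2"
      using supconv_attained[OF K usc] by blast
    obtain z where z: "z \<in> K" "supconv k K (\<lambda>x. - v x) x = - v z - k * (norm (x - z))\<^sup>2"
      using supconv_attained[OF K uscv] by blast
    have "norm (x - y) < s" using near[OF px y z] by blast
    then show ?thesis using \<rho>(2)[OF y(1)] s norm_triangle_sub[of x y] by (simp add: r_def)
  qed
  have Kr: "norm y + 1 \<le> r" if "y \<in> K" for y using \<rho>(2)[OF that] by (simp add: r_def)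
  have "\<kappa> / 16 > 0" using \<kappa> by simp
  obtain x p q A d where px: "norm p \<le> \<delta>" "norm x \<le> r" "\<And>z. norm z \<le> r \<Longrightarrow> w z \<le> w x + p \<bullet> (z - x)"
    and A: "transpose A = A" "d > 0"
    and up: "\<And>h. norm h < d \<Longrightarrow> supconv k K u' (x + h) \<le> supconv k K u' x + q \<bullet> h + (h \<bullet> (A *v h)) / 2 + \<kappa> / 16 * (norm h)\<^sup>2"
    and lo: "\<And>h. norm h < d \<Longrightarrow> supconv k K (\<lambda>x. - v x) (x + h) \<le>
       supconv k K (\<lambda>x. - v x) x - (q - p) \<bullet> h - (h \<bullet> (A *v h)) / 2 + \<kappa> / 16 * (norm h)\<^sup>2"
  proof (rule common_second_order_contact[OF K usc uscv k _ \<delta> \<open>\<kappa> / 16 > 0\<close> w_def])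
    show "norm y + 1 \<le> r" if "y \<in> K" for y by (rule Kr[OF that])
    show "norm x < r" if "norm p \<le> \<delta>" "norm x \<le> r" "\<And>z. norm z \<le> r \<Longrightarrow> w z \<le> w x + p \<bullet> (z - x)" for p x
      by (rule inner[OF that])
  qed (rule that; assumption)
  obtain y where y: "y \<in> K" "supconv k K u' x = u' y - k * (norm (x - y))\<^sup>2"
    using supconv_attained[OF K usc] by blast
  obtain z where z: "z \<in> K" "supconv k K (\<lambda>x. - v x) x = - v z - k * (norm (x - z))\<^sup>2"
    using supconv_attained[OF K uscv] by blast
  have nyz: "norm (x - y) < s" "norm (x - z) < s" "u' y - v z \<ge> m / 2" using near[OF px y z] by auto
  have dyz: "dist y z < 2 * s"
    using dist_triangle3[of y z x] nyz by (simp add: dist_norm)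
  have infy: "2 * r0 < infdist y F" using r0(2)[OF y(1) z(1) nyz(3)] dyz s by simp
  have infz: "r0 < infdist z F"
    using infdist_triangle[of y F z] infy dyz s by simp
  have yX: "y \<in> X" and zX: "z \<in> X" using infy infz r0(1) by (auto simp: X_def)
  then have y\<Omega>: "y \<in> \<Omega>" and z\<Omega>: "z \<in> \<Omega>" using X\<Omega> by auto
  obtain d1 where d1: "d1 > 0" "ball y d1 \<subseteq> \<Omega>" using y\<Omega> assms(2) open_contains_ball by blast
  obtain d2 where d2: "d2 > 0" "ball z d2 \<subseteq> \<Omega>" using z\<Omega> assms(2) open_contains_ball by blast
  have Jp: "(u y, A + (\<kappa> / 8 - \<kappa>) *\<^sub>R mat 1) \<in> Jplus u y"
  proof (rule JplusI_quadratic[OF transpose_add_identity[OF A(1)], where d = "min d d1" and q = "q - \<kappa> *\<^sub>R y"])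
    fix h :: "real^'n" assume h: "norm h < min d d1"
    have "y + h \<in> K" using h d1 \<Omega>K by (auto simp: dist_norm subset_iff)
    from supconv_ge[OF K usc this, of k "x + h"]
    have "u' (y + h) \<le> u' y + q \<bullet> h + (h \<bullet> (A *v h)) / 2 + \<kappa> / 16 * (norm h)\<^sup>2"
      using up[of h] h y(2) by simp
    moreover have "u' (y + h) = u (y + h) + \<kappa> / 2 * ((norm y)\<^sup>2 - \<rho>\<^sup>2) + \<kappa> * (y \<bullet> h) + \<kappa> / 2 * (norm h)\<^sup>2"
      unfolding u'_def norm_add_squared by (simp add: algebra_simps)
    ultimately show "u (y + h) \<le> u y + (q - \<kappa> *\<^sub>R y) \<bullet> h + h \<bullet> ((A + (\<kappa> / 8 - \<kappa>) *\<^sub>R mat 1) *v h) / 2"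
      unfolding matrix_vector_mult_add_rdistrib inner_add_right inner_scaled_identity
      by (simp add: u'_def inner_diff_left field_simps)
  qed (use A d1 in auto)
  have Jm: "(v z, A + (- \<kappa> / 8) *\<^sub>R mat 1) \<in> Jminus v z"
  proof (rule JminusI_quadratic[OF transpose_add_identity[OF A(1)], where d = "min d d2" and q = "q - p"])
    fix h :: "real^'n" assume h: "norm h < min d d2"
    have "z + h \<in> K" using h d2 \<Omega>K by (auto simp: dist_norm subset_iff)
    from supconv_ge[OF K uscv this, of k "x + h"]
    show "v z + (q - p) \<bullet> h + h \<bullet> ((A + (- \<kappa> / 8) *\<^sub>R mat 1) *v h) / 2 \<le> v (z + h)"
      unfolding matrix_vector_mult_add_rdistrib inner_add_right inner_scaled_identity
      using lo[of h] h z(2) by (simp add: diff_divide_distrib)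
  qed (use A d2 in auto)
  have ell: "a + q \<in> \<Theta> x" if "x \<in> \<Omega>" "a \<in> \<Theta> x" "q \<in> Qcone" for x a q
    using assms(4) that unfolding proper_elliptic_map_def by blast
  have "(u y, A + (\<kappa> / 8 - \<kappa>) *\<^sub>R mat 1) \<in> \<Theta> y"
    using assms(7) y\<Omega> Jp unfolding Theta_subharmonic_def by blast
  moreover have "(u' y - u y, 0) \<in> Qcone"
    using u'le[OF y(1)] by (simp add: Qcone_def psd_def SymM_def transpose_def vec_eq_iff)
  ultimately have "(u y, A + (\<kappa> / 8 - \<kappa>) *\<^sub>R mat 1) + (u' y - u y, 0) \<in> \<Theta> y" using ell[OF y\<Omega>] by blast
  moreover have "u' y \<in> {-R..R}"
    using Mu[OF y(1)] Mv[OF z(1)] nyz(3) m R by auto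
  moreover have "A + (\<kappa> / 8 - \<kappa>) *\<^sub>R mat 1 \<in> SymM" unfolding SymM_def mem_Collect_eq
    by (rule transpose_add_identity[OF A(1)])
  ultimately have "(u' y, A + (\<kappa> / 8 - \<kappa>) *\<^sub>R mat 1) \<in> \<Theta> y \<inter> ({-R..R} \<times> SymM)" by simp
  moreover have "dist y z < \<delta>c" using dyz s by simp
  ultimately have "(u' y, A + (\<kappa> / 8 - \<kappa>) *\<^sub>R mat 1 + (\<kappa> / 4) *\<^sub>R mat 1) \<in> \<Theta> z"
    using cont[OF yX zX] by force
  moreover have "A + (\<kappa> / 8 - \<kappa>) *\<^sub>R mat 1 + (\<kappa> / 4) *\<^sub>R mat 1 = A + (\<kappa> / 8 - \<kappa> + \<kappa> / 4) *\<^sub>R mat 1"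
    by (simp only: scaleR_add_left add.assoc)
  ultimately have mem: "(u' y, A + (\<kappa> / 8 - \<kappa> + \<kappa> / 4) *\<^sub>R mat 1) \<in> \<Theta> z" by (simp only:)
  have "(v z, A + (- \<kappa> / 8) *\<^sub>R mat 1) \<in> (top_of_set RS) interior_of (\<Theta> z)"
    by (rule interior_of_elliptic[OF ell[OF z\<Omega>] A(1) mem]) (use nyz m \<kappa> in auto)
  then show False using assms(9) z\<Omega> Jm unfolding Theta_superharmonic_def by blast
qed

end
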